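(* If a rule set is $\mathrm{RPC}_s$, then it never-terminates.
   Context: Setting (restricted disjunctive chase). Rules $\rho$: $\forall \vec w,\vec x.[\beta\to \bigvee_{i=1}^n \exists \vec y_i.\eta_i]$ with frontier $\vec x$, $\mathrm{branching}(\rho)=n$; datalog = $n=1$ without existential variables; skolemization $\mathrm{sk}(\rho)$ replaces $y\in\vec y_i$ by $f^\rho_{i,y}(\vec x)$. Trigger $\lambda=(\rho,\sigma)$: loaded for $F$ if $\mathrm{body}(\rho)\sigma\subseteq F$; obsolete for $F$ if some extension $\sigma'$ of $\sigma$ gives $\mathrm{head}_i(\rho)\sigma'\subseteq F$; $\mathrm{out}_i(\lambda)=\mathrm{head}_i(\mathrm{sk}(\rho))\sigma$; $\mathcal{R}$-triggers use rules of $\mathcal{R}$ and substitutions into terms over $\mathrm{sk}(\mathcal{R})$. Chase trees of $(\mathcal{R},D)$ are rooted at $D$, apply loaded non-obsolete $\mathcal{R}$-triggers (datalog first) with one child per disjunct, leaves satisfy all rules, fairness holds; $\mathcal{R}$ never-terminates if some KB with $\mathcal{R}$ has no finite chase tree. A head-choice $hc$ picks a disjunct per rule; $\mathrm{out}_{hc}(\lambda)=\mathrm{out}_{hc(\rho)}(\lambda)$. Birth facts: $\mathrm{birth}(c)=\emptyset$; $\mathrm{birth}(f^\psi_{i,v}(\vec s))=\mathrm{out}_i((\psi,\tau))\cup\bigcup_s\mathrm{birth}(s)$ with $\tau$ mapping $\mathrm{frontier}(\psi)$ to $\vec s$; $\mathrm{birth}((\psi,\tau))=\bigcup_{x\in\mathrm{frontier}(\psi)}\mathrm{birth}(\tau(x))$;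 $\mathrm{skel}(\lambda)$ = terms of $\mathrm{birth}(\lambda)$ plus constants assigned to frontier variables. $h^{uc}_\lambda$ maps functional terms $f(\vec t)\notin\mathrm{skel}(\lambda)$ to fresh constants $c_f$, terms of $\mathrm{skel}(\lambda)$ and the $c_f$ to themselves, others to a special constant $\star$. $\mathcal{O}(\mathcal{R},hc,\lambda,h)$ is the minimal fact set containing all facts over predicates of $\mathcal{R}$ and constants in $\mathrm{skel}(\lambda)\cup\{\star\}$, including $\mathrm{birth}(\lambda)$, and including $h(\mathrm{out}_{hc}(\lambda'))$ for each $\mathcal{R}$-trigger $\lambda'$ loaded for it with $\mathrm{out}_{hc}(\lambda')\neq\mathrm{out}_{hc}(\lambda)$. $\lambda$ is uc-unblockable for $\mathcal{R}$ and $hc$ if its rule is datalog or it is not obsolete for $\mathcal{O}(\mathcal{R},hc,\lambda,h^{uc}_\lambda)$. $D_\rho=\mathrm{body}(\rho)\sigma_{uc}$ with $\sigma_{uc}$ mapping each variable $x$ to a fresh constant $c_x$. A term is cyclic if it has a subterm $f(\vec s)$ with $f$ occurring in $\vec s$; $\rho$-cyclic if it is $f(\vec s)$ with $f$ from $\mathrm{sk}(\rho)$ occurring in $\vec s$. $\mathrm{RPC}(\mathcal{R},hc,\rho)$ is the (least) fact set including $D_\rho$, $\mathrm{out}_{hc}((\rho,\sigma_{uc}))$, and $\mathrm{out}_{hc}(\lambda)$ for every $\mathcal{R}$-trigger $\lambda=(\psi,\tau)$ with no cyclic term in the range of $\tau$, loaded for $\mathrm{RPC}(\mathcal{R},hc,\rho)$,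 uc-unblockable for $\mathcal{R}$ and $hc$, and with $\tau$ injective if $\psi=\rho$. For $i\ge1$, $hc_i$ is the head-choice with $hc_i(\rho)=i$ if $i\le\mathrm{branching}(\rho)$ and $hc_i(\rho)=\mathrm{branching}(\rho)$ otherwise; $\mathrm{branching}(\mathcal{R})=\max_{\rho\in\mathcal{R}}\mathrm{branching}(\rho)$. $\mathcal{R}$ is $\mathrm{RPC}_s$ if there are $1\le i\le\mathrm{branching}(\mathcal{R})$, a (generating) $\rho\in\mathcal{R}$, and a $\rho$-cyclic term occurring in $\mathrm{RPC}(\mathcal{R},hc_i,\rho)$. *)

theory Defs
  imports Main
begin

section \<open>Rules\<close>

text \<open>
  A predicate is a name together with an arity: the atom \<open>Atom p ts\<close> is built from
  the predicate \<open>(p, length ts)\<close>.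
\<close>

datatype ('p, 'a) atom = Atom (pname: 'p) (args: "'a list")

text \<open>
  A rule is given by its body and its nonempty list of disjuncts. All terms of a rule
  are variables. The variables of the body are universally quantified, the remaining variables of
  a disjunct are existentially quantified in that disjunct.
\<close>

datatype ('p, 'v) rule =
  Rule (body: "('p, 'v) atom list") (heads: "('p, 'v) atom list list")

definition vars :: "('p, 'v) atom list \<Rightarrow> 'v set" where
  "vars as = (\<Union>a\<in>set as. set (args a))"

definition branching :: "('p, 'v) rule \<Rightarrow> nat" where
  "branching \<rho> = length (heads \<rho>)"

text \<open>Disjuncts are numbered from 1.\<close>

definition head :: "nat \<Rightarrow> ('p, 'v) rule \<Rightarrow> ('p, 'v) atom list" where
  "head i \<rho> = heads \<rho> ! (i - 1)"

definition uvars :: "('p, 'v) rule \<Rightarrow> 'v set" where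
  "uvars \<rho> = vars (body \<rho>)"

definition exvars :: "nat \<Rightarrow> ('p, 'v) rule \<Rightarrow> 'v set" where
  "exvars i \<rho> = vars (head i \<rho>) - uvars \<rho>"

text \<open>
  The frontier is a list because it serves as the argument list of the Skolem terms; its order
  (first occurrence in the body) is an arbitrary but fixed choice.
\<close>

definition frontier :: "('p, 'v) rule \<Rightarrow> 'v list" where
  "frontier \<rho> = filter (\<lambda>x. \<exists>\<eta>\<in>set (heads \<rho>). x \<in> vars \<eta>)
                  (remdups (concat (map args (body \<rho>))))"

definition generating :: "('p, 'v) rule \<Rightarrow> bool" where
  "generating \<rho> \<longleftrightarrow> (\<exists>i\<in>{1..branching \<rho>}. exvars i \<rho> \<noteq> {})"

definition datalog :: "('p, 'v) rule \<Rightarrow> bool" where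
  "datalog \<rho> \<longleftrightarrow> branching \<rho> = 1 \<and> \<not> generating \<rho>"

definition rule_set :: "('p, 'v) rule set \<Rightarrow> bool" where
  "rule_set R \<longleftrightarrow> finite R \<and> (\<forall>\<rho>\<in>R. heads \<rho> \<noteq> [])"

definition preds :: "('p, 'v) rule set \<Rightarrow> ('p \<times> nat) set" where
  "preds R = {(pname a, length (args a)) | a \<rho>.
     \<rho> \<in> R \<and> (a \<in> set (body \<rho>) \<or> (\<exists>\<eta>\<in>set (heads \<rho>). a \<in> set \<eta>))}"


section \<open>Ground terms and facts\<close>

text \<open>\<open>Sk \<rho> i y\<close> is the Skolem function symbol $f^\rho_{i,y}$.\<close>

datatype ('p, 'v) fsym = Sk "('p, 'v) rule" nat 'v

text \<open>
  The constants that have to be fresh form separate constructors: \<open>Star\<close> is the special constant,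
  \<open>CFun f\<close> is $c_f$, and \<open>CVar x\<close> is $c_x$.
\<close>

datatype ('p, 'v) const = Star | CFun "('p, 'v) fsym" | CVar 'v | Named nat

datatype ('p, 'v) trm = Const "('p, 'v) const" | Fn "('p, 'v) fsym" "('p, 'v) trm list"

type_synonym ('p, 'v) fact = "('p, ('p, 'v) trm) atom"

type_synonym ('p, 'v) subst = "'v \<Rightarrow> ('p, 'v) trm"

fun subterms :: "('p, 'v) trm \<Rightarrow> ('p, 'v) trm set" where
  "subterms (Const c) = {Const c}"
| "subterms (Fn f ts) = insert (Fn f ts) (\<Union>t\<in>set ts. subterms t)"

fun fsyms :: "('p, 'v) trm \<Rightarrow> ('p, 'v) fsym set" where
  "fsyms (Const c) = {}"
| "fsyms (Fn f ts) = insert f (\<Union>t\<in>set ts. fsyms t)"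

definition terms :: "('p, 'v) fact set \<Rightarrow> ('p, 'v) trm set" where
  "terms F = (\<Union>a\<in>F. \<Union>t\<in>set (args a). subterms t)"

definition sk_fsyms :: "('p, 'v) rule \<Rightarrow> ('p, 'v) fsym set" where
  "sk_fsyms \<rho> = {Sk \<rho> i y | i y. i \<in> {1..branching \<rho>} \<and> y \<in> exvars i \<rho>}"

inductive_set terms_over :: "('p, 'v) rule set \<Rightarrow> ('p, 'v) trm set"
  for R :: "('p, 'v) rule set" where
  "Const c \<in> terms_over R"
| "\<lbrakk>\<rho> \<in> R; f \<in> sk_fsyms \<rho>; length ts = length (frontier \<rho>);
    \<forall>t\<in>set ts. t \<in> terms_over R\<rbrakk> \<Longrightarrow> Fn f ts \<in> terms_over R"

definition cyclic :: "('p, 'v) trm \<Rightarrow> bool" where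
  "cyclic t \<longleftrightarrow> (\<exists>f ts. Fn f ts \<in> subterms t \<and> f \<in> (\<Union>s\<in>set ts. fsyms s))"

definition rule_cyclic :: "('p, 'v) rule \<Rightarrow> ('p, 'v) trm \<Rightarrow> bool" where
  "rule_cyclic \<rho> t \<longleftrightarrow>
     (\<exists>f ts. t = Fn f ts \<and> f \<in> sk_fsyms \<rho> \<and> f \<in> (\<Union>s\<in>set ts. fsyms s))"


section \<open>Triggers\<close>

text \<open>
  Substitutions are total functions; only their values on the universal variables of the
  rule of a trigger matter.
\<close>

type_synonym ('p, 'v) trigger = "('p, 'v) rule \<times> ('p, 'v) subst"

definition inst :: "('p, 'v) subst \<Rightarrow> ('p, 'v) atom list \<Rightarrow> ('p, 'v) fact set" where
  "inst \<sigma> as = map_atom id \<sigma> ` set as"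

definition is_trigger :: "('p, 'v) rule set \<Rightarrow> ('p, 'v) trigger \<Rightarrow> bool" where
  "is_trigger R l \<longleftrightarrow> fst l \<in> R \<and> snd l ` uvars (fst l) \<subseteq> terms_over R"

definition loaded :: "('p, 'v) trigger \<Rightarrow> ('p, 'v) fact set \<Rightarrow> bool" where
  "loaded l F \<longleftrightarrow> inst (snd l) (body (fst l)) \<subseteq> F"

definition obsolete :: "('p, 'v) trigger \<Rightarrow> ('p, 'v) fact set \<Rightarrow> bool" where
  "obsolete l F \<longleftrightarrow> (\<exists>i\<in>{1..branching (fst l)}. \<exists>\<sigma>'.
     (\<forall>x\<in>uvars (fst l). \<sigma>' x = snd l x) \<and> inst \<sigma>' (head i (fst l)) \<subseteq> F)"

definition satisfies :: "('p, 'v) fact set \<Rightarrow> ('p, 'v) rule \<Rightarrow> bool" where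
  "satisfies F \<rho> \<longleftrightarrow> (\<forall>\<sigma>. loaded (\<rho>, \<sigma>) F \<longrightarrow> obsolete (\<rho>, \<sigma>) F)"

text \<open>
  Instantiating the \<open>i\<close>-th disjunct of the Skolemization of \<open>\<rho>\<close> with \<open>\<sigma>\<close> amounts to
  instantiating the \<open>i\<close>-th disjunct of \<open>\<rho>\<close> with the following substitution.
\<close>

definition sk_subst :: "nat \<Rightarrow> ('p, 'v) rule \<Rightarrow> ('p, 'v) subst \<Rightarrow> ('p, 'v) subst" where
  "sk_subst i \<rho> \<sigma> v =
     (if v \<in> exvars i \<rho> then Fn (Sk \<rho> i v) (map \<sigma> (frontier \<rho>)) else \<sigma> v)"

definition out :: "nat \<Rightarrow> ('p, 'v) trigger \<Rightarrow> ('p, 'v) fact set" where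
  "out i l = inst (sk_subst i (fst l) (snd l)) (head i (fst l))"

type_synonym ('p, 'v) head_choice = "('p, 'v) rule \<Rightarrow> nat"

definition out_hc :: "('p, 'v) head_choice \<Rightarrow> ('p, 'v) trigger \<Rightarrow> ('p, 'v) fact set" where
  "out_hc hc l = out (hc (fst l)) l"


section \<open>Chase trees\<close>

definition database :: "('p, 'v) fact set \<Rightarrow> bool" where
  "database D \<longleftrightarrow> finite D \<and> (\<forall>a\<in>D. set (args a) \<subseteq> range Const)"

text \<open>
  The vertices of a tree are addresses: the root is \<open>[]\<close>, and the child of \<open>v\<close> for
  the \<open>i\<close>-th disjunct is \<open>v @ [i]\<close>. The values of \<open>trg\<close> at leaves are irrelevant.
\<close>

definition leaf :: "nat list set \<Rightarrow> nat list \<Rightarrow> bool" where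
  "leaf V v \<longleftrightarrow> v \<in> V \<and> (\<forall>i. v @ [i] \<notin> V)"

definition infinite_branch :: "nat list set \<Rightarrow> (nat \<Rightarrow> nat list) \<Rightarrow> bool" where
  "infinite_branch V b \<longleftrightarrow>
     b 0 = [] \<and> (\<forall>n. b n \<in> V) \<and> (\<forall>n. \<exists>i. b (Suc n) = b n @ [i])"

definition chase_tree ::
  "('p, 'v) rule set \<Rightarrow> ('p, 'v) fact set \<Rightarrow> nat list set \<Rightarrow>
   (nat list \<Rightarrow> ('p, 'v) fact set) \<Rightarrow> (nat list \<Rightarrow> ('p, 'v) trigger) \<Rightarrow> bool" where
  "chase_tree R D V fct trg \<longleftrightarrow>
     [] \<in> V \<and> (\<forall>v i. v @ [i] \<in> V \<longrightarrow> v \<in> V) \<and> fct [] = D \<and>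
     (\<forall>v\<in>V. \<not> leaf V v \<longrightarrow>
        is_trigger R (trg v) \<and> loaded (trg v) (fct v) \<and> \<not> obsolete (trg v) (fct v) \<and>
        (\<not> datalog (fst (trg v)) \<longrightarrow>
           (\<forall>l. is_trigger R l \<and> datalog (fst l) \<and> loaded l (fct v) \<longrightarrow> obsolete l (fct v))) \<and>
        (\<forall>i. v @ [i] \<in> V \<longleftrightarrow> i \<in> {1..branching (fst (trg v))}) \<and>
        (\<forall>i\<in>{1..branching (fst (trg v))}. fct (v @ [i]) = fct v \<union> out i (trg v))) \<and>
     (\<forall>v. leaf V v \<longrightarrow> (\<forall>\<rho>\<in>R. satisfies (fct v) \<rho>)) \<and>
     (\<forall>b n l. infinite_branch V b \<and> is_trigger R l \<and> loaded l (fct (b n)) \<longrightarrow>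
        (\<exists>m\<ge>n. obsolete l (fct (b m))))"

definition never_terminates :: "('p, 'v) rule set \<Rightarrow> bool" where
  "never_terminates R \<longleftrightarrow>
     (\<exists>D. database D \<and> \<not> (\<exists>V fct trg. chase_tree R D V fct trg \<and> finite V))"


section \<open>Unblockability\<close>

fun birth_term :: "('p, 'v) trm \<Rightarrow> ('p, 'v) fact set" where
  "birth_term (Const c) = {}"
| "birth_term (Fn (Sk \<psi> i v) ts) =
     out i (\<psi>, the \<circ> map_of (zip (frontier \<psi>) ts)) \<union> (\<Union>t\<in>set ts. birth_term t)"

definition birth :: "('p, 'v) trigger \<Rightarrow> ('p, 'v) fact set" where
  "birth l = (\<Union>x\<in>set (frontier (fst l)). birth_term (snd l x))"

definition skel :: "('p, 'v) trigger \<Rightarrow> ('p, 'v) trm set" where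
  "skel l = terms (birth l) \<union> (snd l ` set (frontier (fst l)) \<inter> range Const)"

definition h_uc :: "('p, 'v) trigger \<Rightarrow> ('p, 'v) trm \<Rightarrow> ('p, 'v) trm" where
  "h_uc l t = (if t \<in> skel l then t else
     (case t of
        Fn f ts \<Rightarrow> Const (CFun f)
      | Const (CFun f) \<Rightarrow> Const (CFun f)
      | Const _ \<Rightarrow> Const Star))"

inductive_set overapprox ::
  "('p, 'v) rule set \<Rightarrow> ('p, 'v) head_choice \<Rightarrow> ('p, 'v) trigger \<Rightarrow>
   (('p, 'v) trm \<Rightarrow> ('p, 'v) trm) \<Rightarrow> ('p, 'v) fact set"
  for R :: "('p, 'v) rule set" and hc :: "('p, 'v) head_choice" and l :: "('p, 'v) trigger"
    and h :: "('p, 'v) trm \<Rightarrow> ('p, 'v) trm" where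
  constants: "\<lbrakk>(p, length ts) \<in> preds R; set ts \<subseteq> (skel l \<inter> range Const) \<union> {Const Star}\<rbrakk>
    \<Longrightarrow> Atom p ts \<in> overapprox R hc l h"
| birth: "a \<in> birth l \<Longrightarrow> a \<in> overapprox R hc l h"
| trigger: "\<lbrakk>is_trigger R l'; \<forall>b\<in>inst (snd l') (body (fst l')). b \<in> overapprox R hc l h;
    out_hc hc l' \<noteq> out_hc hc l; a \<in> out_hc hc l'\<rbrakk>
    \<Longrightarrow> map_atom id h a \<in> overapprox R hc l h"

definition uc_unblockable ::
  "('p, 'v) rule set \<Rightarrow> ('p, 'v) head_choice \<Rightarrow> ('p, 'v) trigger \<Rightarrow> bool" where
  "uc_unblockable R hc l \<longleftrightarrow>
     datalog (fst l) \<or> \<not> obsolete l (overapprox R hc l (h_uc l))"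


section \<open>Restricted prefix cyclicity\<close>

definition \<sigma>_uc :: "('p, 'v) subst" where
  "\<sigma>_uc x = Const (CVar x)"

inductive_set RPC ::
  "('p, 'v) rule set \<Rightarrow> ('p, 'v) head_choice \<Rightarrow> ('p, 'v) rule \<Rightarrow> ('p, 'v) fact set"
  for R :: "('p, 'v) rule set" and hc :: "('p, 'v) head_choice" and \<rho> :: "('p, 'v) rule" where
  database: "a \<in> inst \<sigma>_uc (body \<rho>) \<Longrightarrow> a \<in> RPC R hc \<rho>"
| start: "a \<in> out_hc hc (\<rho>, \<sigma>_uc) \<Longrightarrow> a \<in> RPC R hc \<rho>"
| trigger: "\<lbrakk>is_trigger R (\<psi>, \<tau>); \<forall>x\<in>uvars \<psi>. \<not> cyclic (\<tau> x);
    \<forall>b\<in>inst \<tau> (body \<psi>). b \<in> RPC R hc \<rho>; uc_unblockable R hc (\<psi>, \<tau>);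
    \<psi> = \<rho> \<longrightarrow> inj_on \<tau> (uvars \<psi>); a \<in> out_hc hc (\<psi>, \<tau>)\<rbrakk>
    \<Longrightarrow> a \<in> RPC R hc \<rho>"

definition hc_const :: "nat \<Rightarrow> ('p, 'v) head_choice" where
  "hc_const i \<rho> = (if i \<le> branching \<rho> then i else branching \<rho>)"

definition set_branching :: "('p, 'v) rule set \<Rightarrow> nat" where
  "set_branching R = Max (branching ` R)"

definition is_RPC_s :: "('p, 'v) rule set \<Rightarrow> bool" where
  "is_RPC_s R \<longleftrightarrow>
     (\<exists>i\<in>{1..set_branching R}. \<exists>\<rho>\<in>R. generating \<rho> \<and>
        (\<exists>t\<in>terms (RPC R (hc_const i) \<rho>). rule_cyclic \<rho> t))"

end

theory Submission
  imports Defs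
begin

text \<open>
  A non-datalog trigger all of whose frontier terms are constants is never uc-unblockable. Hence
  every functional term of RPC contains one of the terms $b_y = f^\rho_{i,y}(\vec c)$
  introduced by the initial trigger, where \<open>cs\<close> is $\vec c$ and \<open>B\<close> the set of all $b_y$.
  As a database we take \<open>init_db\<close>, the initial facts of RPC with each $b_y$ replaced by a
  constant. Suppose it has a finite chase tree, and let \<open>F\<close> be the leaf on the branch
  following the head-choice.

  Consider maps \<open>\<phi>\<close> from the terms of RPC to those of \<open>F\<close> which send the initial facts into \<open>F\<close>
  and commute with the function symbols, except that the first map sends the $b_y$ to their
  constants. Such a map sends all of RPC into \<open>F\<close>: if a lifted unblockable trigger
  were obsolete in \<open>F\<close> but its output not in \<open>F\<close>, then a partial inverse of \<open>\<phi>\<close> would carry \<open>F\<close>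
  into the overapproximation of the trigger and make the trigger obsolete there.

  The trigger $(\rho, \tau)$ which creates the $\rho$-cyclic term produces from \<open>\<phi>\<close> the map that
  substitutes \<open>\<phi> (\<tau> x)\<close> for $c_x$. Since $b_y$ then goes to
  $\varphi(f^\rho_{i,y}(\tau(\vec x)))$, and $\tau(\vec x)$ contains some $b_{y'}$, the images of
  the $b_y$ grow with each iteration, contradicting the finiteness of \<open>F\<close>.
\<close>

section \<open>Terms, subterms and instances of atom lists\<close>

lemma subterms_refl [simp]: "t \<in> subterms t"
  by (cases t) auto

lemma subterms_trans: "s \<in> subterms t \<Longrightarrow> t \<in> subterms u \<Longrightarrow> s \<in> subterms u"
  by (induction u) auto

fun fn_count :: "('p, 'v) trm \<Rightarrow> nat" where
  "fn_count (Const c) = 0"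
| "fn_count (Fn f ts) = Suc (sum_list (map fn_count ts))"

lemma fn_count_arg: "t \<in> set ts \<Longrightarrow> fn_count t < fn_count (Fn f ts)"
  using member_le_sum_list[of "fn_count t" "map fn_count ts"] by auto

lemma fn_count_subterms: "s \<in> subterms t \<Longrightarrow> fn_count s \<le> fn_count t"
proof (induction t)
  case (Fn f ts)
  then show ?case using fn_count_arg[of _ ts f] by fastforce
qed auto

lemma terms_subterms: "s \<in> subterms t \<Longrightarrow> t \<in> terms F \<Longrightarrow> s \<in> terms F"
  unfolding terms_def by (auto intro: subterms_trans)

lemma args_in_terms: "Fn f ts \<in> terms F \<Longrightarrow> t \<in> set ts \<Longrightarrow> t \<in> terms F"
  by (rule terms_subterms[of _ "Fn f ts"]) (auto intro!: bexI[of _ t])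

lemma finite_subterms: "finite (subterms t)"
  by (induction t) auto

lemma finite_terms: "finite F \<Longrightarrow> finite (terms F)"
  unfolding terms_def by (auto intro: finite_subterms)

lemma terms_mono: "F \<subseteq> G \<Longrightarrow> terms F \<subseteq> terms G"
  unfolding terms_def by auto

lemma args_map_atom [simp]: "args (map_atom id f a) = map f (args a)"
  by (cases a) auto

lemma pname_map_atom [simp]: "pname (map_atom id f a) = pname a"
  by (cases a) auto

lemma terms_inst: "terms (inst \<sigma> as) = (\<Union>x\<in>vars as. subterms (\<sigma> x))"
  unfolding terms_def inst_def vars_def by auto

lemma inst_cong:
  assumes "\<And>x. x \<in> vars as \<Longrightarrow> \<sigma> x = \<sigma>' x"
  shows "inst \<sigma> as = inst \<sigma>' as"
proof -
  have "map_atom id \<sigma> a = map_atom id \<sigma>' a" if "a \<in> set as" for a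
  proof (cases a)
    case (Atom p xs)
    then have "set xs \<subseteq> vars as" using that by (force simp: vars_def)
    then show ?thesis using assms Atom by auto
  qed
  then show ?thesis unfolding inst_def by auto
qed

lemma inst_args:
  "a \<in> inst \<sigma> as \<Longrightarrow> t \<in> set (args a) \<Longrightarrow> \<exists>x\<in>vars as. t = \<sigma> x"
  unfolding inst_def vars_def by fastforce

lemma image_inst: "map_atom id f ` inst \<sigma> as = inst (f \<circ> \<sigma>) as"
  unfolding inst_def by (force simp: image_image atom.map_comp)

lemma finite_inst: "finite (inst \<sigma> as)"
  unfolding inst_def by simp

lemma map_atom_ident: "map_atom id (\<lambda>t. t) a = a"
  by (cases a) simp

section \<open>Frontiers and outputs of triggers\<close>

lemma set_frontier:
  "set (frontier \<psi>) = {x \<in> uvars \<psi>. \<exists>\<eta>\<in>set (heads \<psi>). x \<in> vars \<eta>}"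
  unfolding frontier_def uvars_def vars_def by auto

lemma distinct_frontier: "distinct (frontier \<psi>)"
  unfolding frontier_def by simp

lemma head_in_heads: "i \<in> {1..branching \<psi>} \<Longrightarrow> head i \<psi> \<in> set (heads \<psi>)"
  unfolding head_def branching_def by auto

lemma head_var_in_frontier:
  assumes "i \<in> {1..branching \<psi>}" "x \<in> vars (head i \<psi>)" "x \<notin> exvars i \<psi>"
  shows "x \<in> set (frontier \<psi>)"
  using assms head_in_heads[OF assms(1)] unfolding set_frontier exvars_def by auto

lemma body_preds: "\<psi> \<in> R \<Longrightarrow> a \<in> inst \<sigma> (body \<psi>) \<Longrightarrow> (pname a, length (args a)) \<in> preds R"
  unfolding preds_def inst_def by auto

lemma head_preds:
  assumes "\<psi> \<in> R" "i \<in> {1..branching \<psi>}" "a \<in> inst \<sigma> (head i \<psi>)"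
  shows "(pname a, length (args a)) \<in> preds R"
  using assms(1,3) head_in_heads[OF assms(2)] unfolding preds_def inst_def by fastforce

text \<open>Head variables are frontier variables or existential ones, so two maps need only be
  compared on frontier values and on Skolem terms. This is the common tool for commuting a map with
  \<open>out\<close>; taking the identity for \<open>g\<close> gives the image of one output as
  another output.\<close>

lemma out_image_eq:
  fixes f g :: "('p, 'v) trm \<Rightarrow> ('p, 'v) trm"
  assumes i: "i \<in> {1..branching \<psi>}"
    and fr: "\<And>x. x \<in> set (frontier \<psi>) \<Longrightarrow> x \<in> vars (head i \<psi>) \<Longrightarrow> f (\<sigma> x) = g (\<sigma>' x)"
    and ex: "\<And>v. v \<in> exvars i \<psi> \<Longrightarrow>
      f (Fn (Sk \<psi> i v) (map \<sigma> (frontier \<psi>))) = g (Fn (Sk \<psi> i v) (map \<sigma>' (frontier \<psi>)))"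
  shows "map_atom id f ` out i (\<psi>, \<sigma>) = map_atom id g ` out i (\<psi>, \<sigma>')"
proof -
  have "inst (f \<circ> sk_subst i \<psi> \<sigma>) (head i \<psi>) = inst (g \<circ> sk_subst i \<psi> \<sigma>') (head i \<psi>)"
  proof (rule inst_cong)
    fix x assume "x \<in> vars (head i \<psi>)"
    then show "(f \<circ> sk_subst i \<psi> \<sigma>) x = (g \<circ> sk_subst i \<psi> \<sigma>') x"
      using fr[of x] ex[of x] head_var_in_frontier[OF i, of x] by (auto simp: sk_subst_def)
  qed
  then show ?thesis unfolding out_def by (simp add: image_inst)
qed

lemma out_cong:
  assumes i: "i \<in> {1..branching \<psi>}" and "map \<sigma> (frontier \<psi>) = map \<sigma>' (frontier \<psi>)"
  shows "out i (\<psi>, \<sigma>) = out i (\<psi>, \<sigma>')"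
  using out_image_eq[OF i, of "\<lambda>t. t" \<sigma> "\<lambda>t. t" \<sigma>'] assms(2) by (simp add: map_atom_ident)

lemma map_frontier_zip:
  assumes "length ts = length (frontier \<psi>)"
  shows "map (the \<circ> map_of (zip (frontier \<psi>) ts)) (frontier \<psi>) = ts"
  using assms distinct_frontier[of \<psi>] by (auto intro!: nth_equalityI simp: map_of_zip_nth)

lemma terms_out:
  assumes i: "i \<in> {1..branching \<psi>}" and t: "t \<in> terms (out i (\<psi>, \<sigma>))"
  shows "(\<exists>x\<in>set (frontier \<psi>). t \<in> subterms (\<sigma> x)) \<or>
    (\<exists>v\<in>exvars i \<psi>. t = Fn (Sk \<psi> i v) (map \<sigma> (frontier \<psi>)))"
proof -
  from t obtain x where x: "x \<in> vars (head i \<psi>)" "t \<in> subterms (sk_subst i \<psi> \<sigma> x)"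
    unfolding out_def terms_inst by auto
  show ?thesis
    using x head_var_in_frontier[OF i x(1)] by (cases "x \<in> exvars i \<psi>") (auto simp: sk_subst_def)
qed

lemma skolem_in_out:
  "v \<in> exvars i \<psi> \<Longrightarrow> Fn (Sk \<psi> i v) (map \<sigma> (frontier \<psi>)) \<in> terms (out i (\<psi>, \<sigma>))"
  unfolding out_def terms_inst by (rule UN_I[of v]) (auto simp: sk_subst_def exvars_def)

lemma finite_out: "finite (out i l)"
  unfolding out_def by (rule finite_inst)

lemma subterm_birth:
  "s \<in> subterms t \<Longrightarrow> birth_term s \<subseteq> birth_term t"
proof (induction t)
  case (Fn f ts)
  then show ?case by (cases f) auto
qed auto

section \<open>The branch of a chase tree that follows a head-choice\<close>

inductive hc_chase ::
  "('p, 'v) rule set \<Rightarrow> ('p, 'v) head_choice \<Rightarrow> ('p, 'v) fact set \<Rightarrow> ('p, 'v) fact set \<Rightarrow> bool"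
  for R hc D where
  root: "hc_chase R hc D D"
| step: "\<lbrakk>hc_chase R hc D G; is_trigger R l; loaded l G; \<not> obsolete l G\<rbrakk>
    \<Longrightarrow> hc_chase R hc D (G \<union> out_hc hc l)"

lemma hc_chase_mono: "hc_chase R hc D G \<Longrightarrow> D \<subseteq> G"
  by (induction rule: hc_chase.induct) auto

lemma hc_chase_finite: "hc_chase R hc D G \<Longrightarrow> finite D \<Longrightarrow> finite G"
  by (induction rule: hc_chase.induct) (auto simp: out_hc_def finite_out)

text \<open>Among the finitely many vertices whose fact sets are reached by following
  \<open>hc\<close>, one with a longest address is a leaf: otherwise its child for the chosen
  disjunct would be longer.\<close>

lemma finite_chase_tree_hc_leaf:
  assumes hc: "\<forall>\<psi>\<in>R. hc \<psi> \<in> {1..branching \<psi>}"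
    and tree: "chase_tree R D V fct trg" and fin: "finite V"
  obtains F where "hc_chase R hc D F" "\<forall>\<psi>\<in>R. satisfies F \<psi>"
proof -
  define W where "W = {v \<in> V. hc_chase R hc D (fct v)}"
  have "[] \<in> W" using tree unfolding W_def chase_tree_def by (auto intro: hc_chase.root)
  moreover have finW: "finite W" using fin unfolding W_def by simp
  ultimately have "Max (length ` W) \<in> length ` W" by (intro Max_in) auto
  then obtain v where v: "v \<in> W" "length v = Max (length ` W)" by auto
  then have max: "length w \<le> length v" if "w \<in> W" for w using that finW by simp
  have "leaf V v"
  proof (rule ccontr)
    assume "\<not> leaf V v"
    then have *: "is_trigger R (trg v)" "loaded (trg v) (fct v)" "\<not> obsolete (trg v) (fct v)"
      "\<forall>i. v @ [i] \<in> V \<longleftrightarrow> i \<in> {1..branching (fst (trg v))}"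
      "\<forall>i\<in>{1..branching (fst (trg v))}. fct (v @ [i]) = fct v \<union> out i (trg v)"
      using tree v unfolding chase_tree_def W_def by blast+
    have i: "hc (fst (trg v)) \<in> {1..branching (fst (trg v))}"
      using hc *(1) unfolding is_trigger_def by blast
    have "hc_chase R hc D (fct v \<union> out_hc hc (trg v))"
      using v * unfolding W_def by (intro hc_chase.step) auto
    then have "v @ [hc (fst (trg v))] \<in> W"
      using * i unfolding W_def out_hc_def by auto
    then show False using max by fastforce
  qed
  then show ?thesis using that[of "fct v"] v tree unfolding W_def chase_tree_def by blast
qed

section \<open>Substitution for constants, and the collapse of base terms\<close>

fun csubst :: "(('p, 'v) const \<Rightarrow> ('p, 'v) trm) \<Rightarrow> ('p, 'v) trm \<Rightarrow> ('p, 'v) trm" where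
  "csubst \<theta> (Const c) = \<theta> c"
| "csubst \<theta> (Fn f ts) = Fn f (map (csubst \<theta>) ts)"

text \<open>The constants \<open>CFun f\<close> are suitable replacements for the terms in
  \<open>B\<close> because RPC itself contains only constants of the form
  \<open>CVar x\<close>.\<close>

fun collapse :: "('p, 'v) trm set \<Rightarrow> ('p, 'v) trm \<Rightarrow> ('p, 'v) trm" where
  "collapse B (Const c) = Const c"
| "collapse B (Fn f ts) = (if Fn f ts \<in> B then Const (CFun f) else Fn f (map (collapse B) ts))"

lemma csubst_subterms: "s \<in> subterms t \<Longrightarrow> csubst \<theta> s \<in> subterms (csubst \<theta> t)"
  by (induction t) auto

section \<open>The structure of the terms in RPC\<close>

locale rpc =
  fixes R :: "('p, 'v) rule set" and hc :: "('p, 'v) head_choice" and \<rho> :: "('p, 'v) rule"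
  assumes rho: "\<rho> \<in> R" and hc: "\<psi> \<in> R \<Longrightarrow> hc \<psi> \<in> {1..branching \<psi>}"
begin

abbreviation "T \<equiv> terms (RPC R hc \<rho>)"

abbreviation "fsym v \<equiv> Sk \<rho> (hc \<rho>) v"

abbreviation "cs \<equiv> map \<sigma>_uc (frontier \<rho>)"

definition "B = {Fn (fsym y) cs | y. y \<in> exvars (hc \<rho>) \<rho>}"

definition rpc_trigger :: "('p, 'v) rule \<Rightarrow> ('p, 'v) subst \<Rightarrow> bool" where
  "rpc_trigger \<psi> \<tau> \<longleftrightarrow> is_trigger R (\<psi>, \<tau>) \<and> loaded (\<psi>, \<tau>) (RPC R hc \<rho>) \<and>
     uc_unblockable R hc (\<psi>, \<tau>) \<and> (\<psi> = \<rho> \<longrightarrow> inj_on \<tau> (uvars \<psi>)) \<and>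
     out_hc hc (\<psi>, \<tau>) \<subseteq> RPC R hc \<rho>"

lemma hc_rho: "hc \<rho> \<in> {1..branching \<rho>}"
  using hc rho .

lemma start_subset: "out_hc hc (\<rho>, \<sigma>_uc) \<subseteq> RPC R hc \<rho>"
  by (auto intro: RPC.start)

lemma loaded_terms:
  assumes "loaded (\<psi>, \<tau>) F" "x \<in> uvars \<psi>"
  shows "\<tau> x \<in> terms F"
proof -
  have "\<tau> x \<in> terms (inst \<tau> (body \<psi>))"
    using assms(2) unfolding terms_inst uvars_def by (intro UN_I[of x]) auto
  then show ?thesis
    using assms(1) terms_mono[of "inst \<tau> (body \<psi>)" F] unfolding loaded_def by auto
qed

text \<open>
  The overapproximation contains all facts over the constants of the frontier and \<open>Star\<close>,
  so a non-datalog trigger without functional frontier terms is blocked.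
\<close>

lemma functional_frontier_term:
  assumes "is_trigger R (\<psi>, \<tau>)" "uc_unblockable R hc (\<psi>, \<tau>)" "\<not> datalog \<psi>"
  obtains x f ts where "x \<in> set (frontier \<psi>)" "\<tau> x = Fn f ts"
proof (rule ccontr)
  assume "\<not> thesis"
  then have con: "\<tau> x \<in> range Const" if "x \<in> set (frontier \<psi>)" for x
    using that \<open>\<not> thesis\<close> \<open>\<And>x f ts. x \<in> set (frontier \<psi>) \<Longrightarrow> \<tau> x = Fn f ts \<Longrightarrow> thesis\<close>
    by (cases "\<tau> x") blast+
  have psi: "\<psi> \<in> R" using assms(1) unfolding is_trigger_def by auto
  let ?O = "overapprox R hc (\<psi>, \<tau>) (h_uc (\<psi>, \<tau>))"
  let ?\<sigma> = "\<lambda>x. if x \<in> uvars \<psi> then \<tau> x else Const Star"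
  have "inst ?\<sigma> (head (hc \<psi>) \<psi>) \<subseteq> ?O"
  proof
    fix a assume a: "a \<in> inst ?\<sigma> (head (hc \<psi>) \<psi>)"
    obtain p ts where at: "a = Atom p ts" by (cases a)
    have "set ts \<subseteq> (skel (\<psi>, \<tau>) \<inter> range Const) \<union> {Const Star}"
    proof
      fix t assume "t \<in> set ts"
      then obtain x where x: "x \<in> vars (head (hc \<psi>) \<psi>)" "t = ?\<sigma> x"
        using inst_args[OF a, of t] at by auto
      show "t \<in> (skel (\<psi>, \<tau>) \<inter> range Const) \<union> {Const Star}"
      proof (cases "x \<in> uvars \<psi>")
        case True
        then have "x \<in> set (frontier \<psi>)"
          using head_var_in_frontier[OF hc[OF psi] x(1)] by (auto simp: exvars_def)
        then show ?thesis using con x True unfolding skel_def by auto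
      qed (use x in auto)
    qed
    moreover have "(p, length ts) \<in> preds R"
      using head_preds[OF psi hc[OF psi] a] at by simp
    ultimately show "a \<in> ?O" unfolding at by (intro overapprox.constants)
  qed
  then have "obsolete (\<psi>, \<tau>) ?O"
    unfolding obsolete_def using hc[OF psi]
    by (intro bexI[of _ "hc \<psi>"] exI[of _ ?\<sigma>]) auto
  then show False using assms unfolding uc_unblockable_def by simp
qed

lemma exvars_not_datalog:
  "\<psi> \<in> R \<Longrightarrow> v \<in> exvars (hc \<psi>) \<psi> \<Longrightarrow> \<not> datalog \<psi>"
  using hc[of \<psi>] unfolding datalog_def generating_def by blast

text \<open>
  The last condition picks a trigger that is the first to create the Skolem terms over
  \<open>ts\<close>; without it, they could already occur in \<open>\<tau> x\<close> for a non-frontier variable \<open>x\<close>.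
\<close>

lemma RPC_skolem_term:
  assumes "Fn f ts \<in> T"
  obtains \<psi> \<tau> v where "f = Sk \<psi> (hc \<psi>) v" "v \<in> exvars (hc \<psi>) \<psi>" "\<psi> \<in> R"
    "ts = map \<tau> (frontier \<psi>)" "out_hc hc (\<psi>, \<tau>) \<subseteq> RPC R hc \<rho>"
    "(\<psi> = \<rho> \<and> \<tau> = \<sigma>_uc) \<or>
     (rpc_trigger \<psi> \<tau> \<and> (\<forall>x\<in>uvars \<psi>. \<forall>w. Fn (Sk \<psi> (hc \<psi>) w) ts \<notin> subterms (\<tau> x)))"
proof -
  \<comment> \<open>The existential variable is kept out of \<open>Q\<close>: a trigger found for
    one Skolem term creates all Skolem terms over the same arguments. So if a sibling of the new
    term already occurs in the body, the induction hypothesis for the sibling serves the new term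
    too.\<close>
  define Q where "Q \<psi> \<tau> ts \<longleftrightarrow> \<psi> \<in> R \<and>
    ts = map \<tau> (frontier \<psi>) \<and> out_hc hc (\<psi>, \<tau>) \<subseteq> RPC R hc \<rho> \<and>
    ((\<psi> = \<rho> \<and> \<tau> = \<sigma>_uc) \<or>
     (rpc_trigger \<psi> \<tau> \<and> (\<forall>x\<in>uvars \<psi>. \<forall>w. Fn (Sk \<psi> (hc \<psi>) w) ts \<notin> subterms (\<tau> x))))"
    for \<psi> \<tau> ts
  let ?P = "\<lambda>f ts. \<exists>\<psi> \<tau> v. f = Sk \<psi> (hc \<psi>) v \<and> v \<in> exvars (hc \<psi>) \<psi> \<and> Q \<psi> \<tau> ts"
  obtain a where "a \<in> RPC R hc \<rho>" "Fn f ts \<in> terms {a}"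
    using assms unfolding terms_def by auto
  then have "?P f ts"
  proof (induction arbitrary: f ts rule: RPC.induct)
    case (database a)
    then have "Fn f ts \<in> terms (inst \<sigma>_uc (body \<rho>))" unfolding terms_def by auto
    then show ?case unfolding terms_inst by (auto simp: \<sigma>_uc_def)
  next
    case (start a)
    then have "Fn f ts \<in> terms (out (hc \<rho>) (\<rho>, \<sigma>_uc))" unfolding terms_def out_hc_def by auto
    then show ?case
      using terms_out[OF hc_rho] start_subset rho unfolding Q_def by (fastforce simp: \<sigma>_uc_def)
  next
    case (trigger \<psi> \<tau> a)
    then have psi: "\<psi> \<in> R" unfolding is_trigger_def by auto
    have tr: "rpc_trigger \<psi> \<tau>"
      unfolding rpc_trigger_def loaded_def using trigger by (auto intro: RPC.trigger)
    have IH: "?P g us" if "x \<in> uvars \<psi>" "Fn g us \<in> subterms (\<tau> x)" for x g us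
    proof -
      have "Fn g us \<in> terms (inst \<tau> (body \<psi>))" using that unfolding terms_inst uvars_def by auto
      then obtain b where "b \<in> inst \<tau> (body \<psi>)" "Fn g us \<in> terms {b}" unfolding terms_def by auto
      then show ?thesis using trigger.IH by blast
    qed
    have "Fn f ts \<in> terms (out (hc \<psi>) (\<psi>, \<tau>))"
      using trigger.hyps trigger.prems unfolding terms_def out_hc_def by auto
    from terms_out[OF hc[OF psi] this]
    consider x where "x \<in> uvars \<psi>" "Fn f ts \<in> subterms (\<tau> x)"
      | v where "v \<in> exvars (hc \<psi>) \<psi>" "f = Sk \<psi> (hc \<psi>) v" "ts = map \<tau> (frontier \<psi>)"
      unfolding set_frontier by auto
    then show ?case
    proof cases
      case 1
      then show ?thesis by (rule IH)
    next
      case 2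
      show ?thesis
      proof (cases "\<exists>x\<in>uvars \<psi>. \<exists>w. Fn (Sk \<psi> (hc \<psi>) w) ts \<in> subterms (\<tau> x)")
        case True
        then obtain x w where "x \<in> uvars \<psi>" "Fn (Sk \<psi> (hc \<psi>) w) ts \<in> subterms (\<tau> x)" by blast
        from IH[OF this] obtain \<tau>' where "Q \<psi> \<tau>' ts" by auto
        then show ?thesis using 2 by auto
      next
        case False
        then have "Q \<psi> \<tau> ts" using tr 2(3) psi unfolding Q_def rpc_trigger_def by blast
        then show ?thesis using 2 by blast
      qed
    qed
  qed
  then show ?thesis unfolding Q_def by (elim exE conjE) (rule that)
qed

lemma frontier_uvars: "x \<in> set (frontier \<psi>) \<Longrightarrow> x \<in> uvars \<psi>"
  unfolding set_frontier by simp

lemma RPC_const: "Const c \<in> T \<Longrightarrow> \<exists>x\<in>uvars \<rho>. c = CVar x"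
proof -
  assume "Const c \<in> T"
  then obtain a where "a \<in> RPC R hc \<rho>" "Const c \<in> terms {a}"
    unfolding terms_def by auto
  then show ?thesis
  proof (induction rule: RPC.induct)
    case (database a)
    then have "Const c \<in> terms (inst \<sigma>_uc (body \<rho>))" unfolding terms_def by auto
    then show ?case unfolding terms_inst uvars_def by (auto simp: \<sigma>_uc_def)
  next
    case (start a)
    then have "Const c \<in> terms (out (hc \<rho>) (\<rho>, \<sigma>_uc))" unfolding terms_def out_hc_def by auto
    then show ?case
      using terms_out[OF hc_rho] frontier_uvars by (fastforce simp: \<sigma>_uc_def)
  next
    case (trigger \<psi> \<tau> a)
    then have psi: "\<psi> \<in> R" unfolding is_trigger_def by auto
    have "Const c \<in> terms (out (hc \<psi>) (\<psi>, \<tau>))"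
      using trigger.hyps trigger.prems unfolding terms_def out_hc_def by auto
    from terms_out[OF hc[OF psi] this] obtain x where "x \<in> uvars \<psi>" "Const c \<in> subterms (\<tau> x)"
      by (auto dest: frontier_uvars)
    then have "Const c \<in> terms (inst \<tau> (body \<psi>))" unfolding terms_inst uvars_def by auto
    then obtain b where "b \<in> inst \<tau> (body \<psi>)" "Const c \<in> terms {b}" unfolding terms_def by auto
    then show ?case using trigger.IH by blast
  qed
qed

lemma T_cases:
  assumes "t \<in> T"
  obtains x where "x \<in> uvars \<rho>" "t = \<sigma>_uc x" | f ts where "t = Fn f ts"
  using assms RPC_const by (cases t) (auto simp: \<sigma>_uc_def)

lemma T_terms_over: "t \<in> T \<Longrightarrow> t \<in> terms_over R"
proof (induction t)
  case (Fn f ts)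
  obtain \<psi> \<tau> v where *: "f = Sk \<psi> (hc \<psi>) v" "v \<in> exvars (hc \<psi>) \<psi>" "\<psi> \<in> R"
    "ts = map \<tau> (frontier \<psi>)" using RPC_skolem_term[OF Fn.prems] by metis
  show ?case
    using * hc[OF *(3)] Fn.IH args_in_terms[OF Fn.prems]
    by (intro terms_over.intros(2)[of \<psi>]) (auto simp: sk_fsyms_def)
qed (rule terms_over.intros)

text \<open>Unless the creating trigger is the initial one, one of its frontier values is
  functional. This value is an argument of the term and has fewer function symbols, so the descent
  ends in \<open>B\<close>. For terms outside \<open>B\<close> the base term lies strictly below the
  root, which later makes the images grow.\<close>

lemma base_subterm:
  assumes "Fn f ts \<in> T"
  shows "Fn f ts \<in> B \<or> (\<exists>t\<in>set ts. \<exists>b\<in>B. b \<in> subterms t)"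
  using assms
proof (induction "Fn f ts" arbitrary: f ts rule: measure_induct_rule[of fn_count])
  case less
  obtain \<psi> \<tau> v where *: "f = Sk \<psi> (hc \<psi>) v" "v \<in> exvars (hc \<psi>) \<psi>" "\<psi> \<in> R"
    "ts = map \<tau> (frontier \<psi>)" "(\<psi> = \<rho> \<and> \<tau> = \<sigma>_uc) \<or> rpc_trigger \<psi> \<tau>"
    using RPC_skolem_term[OF less.prems] by metis
  from *(5) show ?case
  proof
    assume "\<psi> = \<rho> \<and> \<tau> = \<sigma>_uc"
    then show ?thesis using * unfolding B_def by auto
  next
    assume "rpc_trigger \<psi> \<tau>"
    then obtain x g us where x: "x \<in> set (frontier \<psi>)" "\<tau> x = Fn g us"
      using functional_frontier_term exvars_not_datalog[OF *(3,2)] unfolding rpc_trigger_def by metis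
    have mem: "Fn g us \<in> set ts" using x *(4) by force
    have "fn_count (Fn g us) < fn_count (Fn f ts)" using mem by (rule fn_count_arg)
    then have "Fn g us \<in> B \<or> (\<exists>t\<in>set us. \<exists>b\<in>B. b \<in> subterms t)"
      using less.hyps args_in_terms[OF less.prems mem] by blast
    then have "\<exists>b\<in>B. b \<in> subterms (Fn g us)" by auto
    then show ?thesis using mem by blast
  qed
qed

lemma functional_contains_base: "Fn f ts \<in> T \<Longrightarrow> \<exists>b\<in>B. b \<in> subterms (Fn f ts)"
  using base_subterm[of f ts] by (auto intro: subterms_refl)

lemma B_in_T: "b \<in> B \<Longrightarrow> b \<in> T"
  using skolem_in_out[of _ "hc \<rho>" \<rho> \<sigma>_uc] terms_mono[OF start_subset]
  unfolding B_def out_hc_def by auto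

section \<open>Birth facts and skeletons of the triggers of RPC\<close>

text \<open>\<open>birth_term\<close> rebuilds a substitution from an argument list. It agrees with
  \<tau> on the frontier, and the output depends on nothing else.\<close>

lemma birth_out:
  assumes "Fn (Sk \<psi> i v) (map \<tau> (frontier \<psi>)) \<in> T"
  shows "out i (\<psi>, the \<circ> map_of (zip (frontier \<psi>) (map \<tau> (frontier \<psi>)))) = out i (\<psi>, \<tau>)"
proof -
  have "i = hc \<psi>" "\<psi> \<in> R" by (rule RPC_skolem_term[OF assms]; simp)+
  then show ?thesis using hc by (intro out_cong) (auto simp: map_frontier_zip)
qed

lemma birth_term_T:
  "t \<in> T \<Longrightarrow> birth_term t \<subseteq> RPC R hc \<rho>"
proof (induction t)
  case (Fn f ts)
  obtain \<psi> \<tau> v where *: "f = Sk \<psi> (hc \<psi>) v" "v \<in> exvars (hc \<psi>) \<psi>" "\<psi> \<in> R"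
    "ts = map \<tau> (frontier \<psi>)" "out_hc hc (\<psi>, \<tau>) \<subseteq> RPC R hc \<rho>"
    using RPC_skolem_term[OF Fn.prems] by metis
  show ?case
    using *(5) Fn.IH args_in_terms[OF Fn.prems] birth_out[of \<psi> "hc \<psi>" v \<tau>] Fn.prems
    unfolding *(1,4) out_hc_def by auto
qed simp

lemma functional_in_birth:
  assumes "Fn f ts \<in> T"
  shows "Fn f ts \<in> terms (birth_term (Fn f ts))"
proof -
  obtain \<psi> \<tau> v where *: "f = Sk \<psi> (hc \<psi>) v" "v \<in> exvars (hc \<psi>) \<psi>" "\<psi> \<in> R"
    "ts = map \<tau> (frontier \<psi>)" "out_hc hc (\<psi>, \<tau>) \<subseteq> RPC R hc \<rho>"
    using RPC_skolem_term[OF assms] by metis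
  have "out (hc \<psi>) (\<psi>, \<tau>) \<subseteq> birth_term (Fn f ts)"
    using birth_out[of \<psi> "hc \<psi>" v \<tau>] assms unfolding *(1,4) by auto
  then show ?thesis using skolem_in_out[OF *(2)] terms_mono unfolding *(1,4) by blast
qed

lemma base_birth: "b \<in> B \<Longrightarrow> out_hc hc (\<rho>, \<sigma>_uc) \<subseteq> birth_term b"
  using birth_out[of \<rho> "hc \<rho>" _ \<sigma>_uc] B_in_T[of b] unfolding B_def out_hc_def by auto

lemma rpc_trigger_uvar: "rpc_trigger \<psi> \<tau> \<Longrightarrow> x \<in> uvars \<psi> \<Longrightarrow> \<tau> x \<in> T"
  using loaded_terms[of \<psi> \<tau> "RPC R hc \<rho>"] unfolding rpc_trigger_def by blast

text \<open>Constants are in the skeleton by definition, and a functional term occurs in its own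
  birth facts. Hence an inverse of \<phi> on the skeleton recovers all frontier values.\<close>

lemma frontier_in_skel:
  assumes "rpc_trigger \<psi> \<tau>" "x \<in> set (frontier \<psi>)"
  shows "\<tau> x \<in> skel (\<psi>, \<tau>)"
proof (cases "\<tau> x")
  case (Const c)
  then have "\<tau> x \<in> \<tau> ` set (frontier \<psi>) \<inter> range Const" using assms(2) by blast
  then show ?thesis unfolding skel_def by auto
next
  case (Fn f ts)
  have "\<tau> x \<in> terms (birth_term (\<tau> x))"
    using functional_in_birth rpc_trigger_uvar[OF assms(1) frontier_uvars[OF assms(2)]] Fn by metis
  moreover have "birth_term (\<tau> x) \<subseteq> birth (\<psi>, \<tau>)" using assms(2) unfolding birth_def by auto
  ultimately show ?thesis unfolding skel_def using terms_mono by blast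
qed

lemma skel_subset_T:
  assumes "rpc_trigger \<psi> \<tau>"
  shows "skel (\<psi>, \<tau>) \<subseteq> T"
proof -
  have "birth (\<psi>, \<tau>) \<subseteq> RPC R hc \<rho>"
    using birth_term_T[OF rpc_trigger_uvar[OF assms frontier_uvars]] unfolding birth_def by auto
  then have "terms (birth (\<psi>, \<tau>)) \<subseteq> T" by (rule terms_mono)
  moreover have "\<tau> ` set (frontier \<psi>) \<subseteq> T"
    using rpc_trigger_uvar[OF assms frontier_uvars] by auto
  ultimately show ?thesis unfolding skel_def by auto
qed

lemma skel_args: "Fn f ts \<in> skel l \<Longrightarrow> t \<in> set ts \<Longrightarrow> t \<in> skel l"
  unfolding skel_def using args_in_terms[of f ts "birth l" t] by blast

text \<open>Some functional frontier value contains a term of \<open>B\<close>, whose birth facts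
  include the output of the initial trigger. So the overapproximation of every such trigger contains
  this output.\<close>

lemma start_subset_birth:
  assumes "rpc_trigger \<psi> \<tau>" "\<not> datalog \<psi>"
  shows "out_hc hc (\<rho>, \<sigma>_uc) \<subseteq> birth (\<psi>, \<tau>)"
proof -
  obtain x f ts where x: "x \<in> set (frontier \<psi>)" "\<tau> x = Fn f ts"
    using functional_frontier_term assms unfolding rpc_trigger_def by metis
  then obtain b where "b \<in> B" "b \<in> subterms (\<tau> x)"
    using functional_contains_base rpc_trigger_uvar[OF assms(1) frontier_uvars] by metis
  then have "out_hc hc (\<rho>, \<sigma>_uc) \<subseteq> birth_term (\<tau> x)"
    using base_birth subterm_birth by blast
  then show ?thesis using x(1) unfolding birth_def by fastforce
qed

section \<open>Liftings and their injectivity\<close>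

text \<open>For a substitution, \<open>Fn (fsym y) (map \<phi> cs)\<close> is the image of $b_y$, so
  the last condition keeps the images of the base terms out of the images of the $c_x$. Together
  with injectivity on the $c_x$ this yields injectivity on all of \<open>T\<close>.\<close>

definition lifting :: "(('p, 'v) trm \<Rightarrow> ('p, 'v) trm) \<Rightarrow> bool" where
  "lifting \<phi> \<longleftrightarrow> (\<phi> = collapse B \<or> (\<exists>\<theta>. \<phi> = csubst \<theta>)) \<and>
     inj_on \<phi> (\<sigma>_uc ` uvars \<rho>) \<and>
     (\<forall>x\<in>uvars \<rho>. \<forall>y. Fn (fsym y) (map \<phi> cs) \<notin> subterms (\<phi> (\<sigma>_uc x)))"

lemma lifting_collapse: "lifting (collapse B)"
  unfolding lifting_def by (auto simp: inj_on_def \<sigma>_uc_def)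

lemma lifting_cases:
  assumes "lifting \<phi>"
  obtains "\<phi> = collapse B" "\<And>x. \<phi> (\<sigma>_uc x) = \<sigma>_uc x"
    | \<theta> where "\<phi> = csubst \<theta>" "\<And>f ts. \<phi> (Fn f ts) = Fn f (map \<phi> ts)"
  using assms unfolding lifting_def by (force simp: \<sigma>_uc_def)

lemma lifting_nonbase: "lifting \<phi> \<Longrightarrow> Fn f ts \<notin> B \<Longrightarrow> \<phi> (Fn f ts) = Fn f (map \<phi> ts)"
  by (erule lifting_cases) auto

lemma lifting_Fn:
  assumes "lifting \<phi>" "\<phi> (Fn f ts) = Fn g us"
  shows "f = g" "map \<phi> ts = us"
  using assms(1) by (cases rule: lifting_cases; use assms(2) in \<open>simp split: if_splits\<close>)+

text \<open>For a term of \<open>B\<close> this is the last condition of \<open>lifting\<close>.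
  Otherwise an argument contains some \<open>b\<close> in \<open>B\<close>, and \<phi>
  \<open>b\<close> would occur in the image of $c_x$ together with \<open>S\<close>. Siblings, and
  not just the term itself, are considered because \<open>old\<close> is closed under them.\<close>

lemma lifting_sibling:
  assumes lift: "lifting \<phi>" and t: "Fn f ts \<in> T" "\<phi> (Fn f ts) = Fn (Sk \<psi> j w) S"
    and x: "x \<in> uvars \<rho>"
  shows "Fn (Sk \<psi> j w') S \<notin> subterms (\<phi> (\<sigma>_uc x))"
  using lift
proof (cases rule: lifting_cases)
  case 1
  then show ?thesis by (simp add: \<sigma>_uc_def)
next
  case (2 \<theta>)
  then have S: "f = Sk \<psi> j w" "S = map \<phi> ts" using t by auto
  from base_subterm[OF t(1)] show ?thesis
  proof
    assume "Fn f ts \<in> B"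
    then have "Sk \<psi> j w' = fsym w'" "ts = cs" using S unfolding B_def by auto
    then show ?thesis using lift x S unfolding lifting_def by auto
  next
    assume "\<exists>t\<in>set ts. \<exists>b\<in>B. b \<in> subterms t"
    then obtain t' b where b: "t' \<in> set ts" "b \<in> B" "b \<in> subterms t'" by blast
    then have "\<phi> b \<in> subterms (Fn (Sk \<psi> j w') S)"
      using csubst_subterms[OF b(3), of \<theta>] unfolding S 2(1) by auto
    moreover from b(2) obtain y where "b = Fn (fsym y) cs" unfolding B_def by auto
    then have "\<phi> b \<notin> subterms (\<phi> (\<sigma>_uc x))"
      using lift x 2(2) unfolding lifting_def by simp
    ultimately show ?thesis using subterms_trans by blast
  qed
qed

lemma lifting_not_subterm:
  assumes lift: "lifting \<phi>" and t: "Fn f ts \<in> T" and x: "x \<in> uvars \<rho>"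
  shows "\<phi> (Fn f ts) \<notin> subterms (\<phi> (\<sigma>_uc x))"
  using lift
proof (cases rule: lifting_cases)
  case 1
  then show ?thesis by (simp add: \<sigma>_uc_def)
next
  case (2 \<theta>)
  then show ?thesis using lifting_sibling[OF lift t _ x] by (cases f) auto
qed

text \<open>Constants are separated by assumption, and a constant from a functional term because the
  image of the latter does not occur in that of the former. Two functional terms are compared
  argument by argument. Under \<open>collapse B\<close>, exactly the functional terms of
  \<open>B\<close> become constants, and the symbol determines a term of \<open>B\<close>, as all of
  them have the arguments \<open>cs\<close>.\<close>

lemma lifting_inj:
  assumes lift: "lifting \<phi>"
  shows "inj_on \<phi> T"
proof -
  have "t = t'" if "t \<in> T" "t' \<in> T" "\<phi> t = \<phi> t'" for t t'
    using that
  proof (induction t arbitrary: t')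
    case (Const c)
    then obtain x where x: "x \<in> uvars \<rho>" "Const c = \<sigma>_uc x"
      using RPC_const by (auto simp: \<sigma>_uc_def)
    from Const.prems(2) show ?case
    proof (cases rule: T_cases)
      case (1 x')
      then show ?thesis using x Const.prems lift unfolding lifting_def inj_on_def by auto
    next
      case (2 f ts)
      then show ?thesis
        using lifting_not_subterm[OF lift _ x(1), of f ts] Const.prems x by auto
    qed
  next
    case (Fn f ts)
    from Fn.prems(2) show ?case
    proof (cases rule: T_cases)
      case (1 x)
      then show ?thesis
        using lifting_not_subterm[OF lift _ 1(1), of f ts] Fn.prems by auto
    next
      case (2 g us)
      have rec: "Fn f ts = Fn g us" if "\<phi> (Fn f ts) = Fn f (map \<phi> ts)" "\<phi> (Fn g us) = Fn g (map \<phi> us)"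
      proof -
        have eq: "f = g" "map \<phi> ts = map \<phi> us" using that Fn.prems(3) 2 by auto
        have "ts = us"
        proof (rule nth_equalityI)
          show len: "length ts = length us" using eq(2) map_eq_imp_length_eq by blast
          fix i assume i: "i < length ts"
          then have "\<phi> (ts ! i) = \<phi> (us ! i)" using eq(2) len by (metis nth_map)
          then show "ts ! i = us ! i"
            using Fn.IH[of "ts ! i" "us ! i"] i len args_in_terms[OF Fn.prems(1)]
              args_in_terms[of g us] Fn.prems(2) 2 by simp
        qed
        then show ?thesis using eq by simp
      qed
      from lift show ?thesis
      proof (cases rule: lifting_cases)
        case 1
        have eq: "\<phi> (Fn f ts) = \<phi> (Fn g us)" using Fn.prems(3) 2 by simp
        have base: "\<phi> (Fn h vs) = Const (CFun h)" if "Fn h vs \<in> B" for h vs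
          using that 1(1) by simp
        note nonbase = lifting_nonbase[OF lift]
        show ?thesis
        proof (cases "Fn f ts \<in> B")
          case True
          then have "Fn g us \<in> B" "f = g" using eq base nonbase[of g us] by force+
          then show ?thesis using True 2 unfolding B_def by blast
        next
          case False
          then have "Fn g us \<notin> B" using eq base nonbase[of f ts] by force
          then show ?thesis using False nonbase rec 2 by blast
        qed
      next
        case (2 \<theta>)
        then show ?thesis using rec \<open>t' = Fn g us\<close> by simp
      qed
    qed
  qed
  then show ?thesis by (auto intro: inj_onI)
qed

lemma lifting_subterms:
  assumes lift: "lifting \<phi>"
  shows "t \<in> T \<Longrightarrow> u \<in> subterms (\<phi> t) \<Longrightarrow>
    u \<in> \<phi> ` subterms t \<or> (\<exists>x\<in>uvars \<rho>. u \<in> subterms (\<phi> (\<sigma>_uc x)))"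
proof (induction t)
  case (Const c)
  then show ?case using RPC_const by (fastforce simp: \<sigma>_uc_def)
next
  case (Fn f ts)
  show ?case
  proof (cases "\<phi> (Fn f ts) = Fn f (map \<phi> ts)")
    case True
    then consider "u = \<phi> (Fn f ts)" | t where "t \<in> set ts" "u \<in> subterms (\<phi> t)"
      using Fn.prems(2) by auto
    then show ?thesis
    proof cases
      case 1
      then show ?thesis by auto
    next
      case 2
      then show ?thesis using Fn.IH[OF 2(1) args_in_terms[OF Fn.prems(1) 2(1)] 2(2)] by auto
    qed
  next
    case False
    from lift show ?thesis
      by (cases rule: lifting_cases) (use False Fn.prems in \<open>auto split: if_splits\<close>)
  qed
qed

section \<open>Outputs of lifted triggers\<close>

text \<open>The frontier has a functional value, while the arguments of base terms are constants.
  Hence even \<open>collapse B\<close> commutes with the Skolem symbols of these triggers.\<close>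

lemma trigger_term_not_base:
  assumes "rpc_trigger \<psi> \<tau>" "v \<in> exvars (hc \<psi>) \<psi>"
  shows "Fn f (map \<tau> (frontier \<psi>)) \<notin> B"
proof
  assume B: "Fn f (map \<tau> (frontier \<psi>)) \<in> B"
  have "\<psi> \<in> R" using assms(1) unfolding rpc_trigger_def is_trigger_def by auto
  then obtain x g us where x: "x \<in> set (frontier \<psi>)" "\<tau> x = Fn g us"
    using functional_frontier_term exvars_not_datalog assms unfolding rpc_trigger_def by metis
  then have "\<tau> x \<in> set (map \<tau> (frontier \<psi>))" unfolding set_map by blast
  also have "map \<tau> (frontier \<psi>) = cs" using B unfolding B_def by blast
  also have "set cs \<subseteq> range Const" by (auto simp: \<sigma>_uc_def)
  finally show False using x by auto
qed

lemma lifting_out: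
  assumes "lifting \<phi>" "rpc_trigger \<psi> \<tau>"
  shows "map_atom id \<phi> ` out_hc hc (\<psi>, \<tau>) = out_hc hc (\<psi>, \<phi> \<circ> \<tau>)"
proof -
  have "\<psi> \<in> R" using assms(2) unfolding rpc_trigger_def is_trigger_def by auto
  from out_image_eq[OF hc[OF this], of \<phi> \<tau> "\<lambda>t. t" "\<phi> \<circ> \<tau>"]
  show ?thesis
    using lifting_nonbase[OF assms(1) trigger_term_not_base[OF assms(2)]]
    unfolding out_hc_def by (simp add: map_atom_ident)
qed

text \<open>
  Together with each functional subterm of some $\varphi(c_x)$, \<open>old\<close> contains all terms created by
  the same trigger. The partial inverse sends them to \<open>Star\<close> (or $c_x$) rather than to
  $c_f$, so that the facts creating them are sent to facts over constants.
\<close>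

definition old :: "(('p, 'v) trm \<Rightarrow> ('p, 'v) trm) \<Rightarrow> ('p, 'v) trm set" where
  "old \<phi> = {Fn (Sk \<psi> j w) S | \<psi> j w S.
     \<exists>x\<in>uvars \<rho>. \<exists>w'. Fn (Sk \<psi> j w') S \<in> subterms (\<phi> (\<sigma>_uc x))}"

text \<open>Unlike under \<open>h_uc\<close>, a constant \<open>CFun f\<close> outside the image of
  the skeleton goes to \<open>Star\<close>. Such constants occur in \<open>init_db\<close>, whose
  facts have to become facts over constants or birth facts.\<close>

definition retract ::
  "(('p, 'v) trm \<Rightarrow> ('p, 'v) trm) \<Rightarrow> ('p, 'v) trigger \<Rightarrow> ('p, 'v) trm \<Rightarrow> ('p, 'v) trm" where
  "retract \<phi> l u =
     (if u \<in> \<phi> ` skel l then inv_into (skel l) \<phi> u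
      else if u \<in> old \<phi> then Const Star
      else (case u of Fn f ts \<Rightarrow> Const (CFun f) | Const c \<Rightarrow> Const Star))"

section \<open>The database obtained from the initial facts\<close>

definition "init = inst \<sigma>_uc (body \<rho>) \<union> out_hc hc (\<rho>, \<sigma>_uc)"

definition "init_db = map_atom id (collapse B) ` init"

lemma init_args:
  assumes "b \<in> init" "t \<in> set (args b)"
  shows "t \<in> B \<or> t \<in> \<sigma>_uc ` uvars \<rho>"
  using assms(1) unfolding init_def
proof
  assume "b \<in> inst \<sigma>_uc (body \<rho>)"
  then show ?thesis using inst_args[OF _ assms(2)] unfolding uvars_def by blast
next
  assume "b \<in> out_hc hc (\<rho>, \<sigma>_uc)"
  then obtain x where x: "x \<in> vars (head (hc \<rho>) \<rho>)" "t = sk_subst (hc \<rho>) \<rho> \<sigma>_uc x"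
    using inst_args[OF _ assms(2)] unfolding out_hc_def out_def by auto
  then show ?thesis
    using frontier_uvars[OF head_var_in_frontier[OF hc_rho x(1)]]
    unfolding sk_subst_def B_def by auto
qed

lemma init_preds: "b \<in> init \<Longrightarrow> (pname b, length (args b)) \<in> preds R"
  unfolding init_def out_hc_def out_def
  using body_preds[OF rho] head_preds[OF rho hc_rho] by auto

lemma collapse_const: "t \<in> B \<or> t \<in> \<sigma>_uc ` uvars \<rho> \<Longrightarrow> collapse B t \<in> range Const"
  by (auto simp: B_def \<sigma>_uc_def)

lemma database_init_db: "database init_db"
  unfolding database_def
proof (intro conjI ballI)
  show "finite init_db"
    unfolding init_db_def init_def out_hc_def by (simp add: finite_inst finite_out)
  fix a assume "a \<in> init_db"
  then show "set (args a) \<subseteq> range Const"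
    using init_args collapse_const unfolding init_db_def by fastforce
qed

text \<open>The constants that replace the $b_y$ are witnesses for the existential variables of the
  chosen disjunct. So the chase never applies \<rho> with the frontier values
  \<open>cs\<close>.\<close>

lemma init_db_obsolete:
  assumes "init_db \<subseteq> G" "map \<tau> (frontier \<rho>) = cs"
  shows "obsolete (\<rho>, \<tau>) G"
proof -
  let ?\<sigma> = "\<lambda>x. if x \<in> uvars \<rho> then \<tau> x else Const (CFun (fsym x))"
  have "inst ?\<sigma> (head (hc \<rho>) \<rho>) = inst (collapse B \<circ> sk_subst (hc \<rho>) \<rho> \<sigma>_uc) (head (hc \<rho>) \<rho>)"
  proof (rule inst_cong)
    fix x assume x: "x \<in> vars (head (hc \<rho>) \<rho>)"
    show "?\<sigma> x = (collapse B \<circ> sk_subst (hc \<rho>) \<rho> \<sigma>_uc) x"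
    proof (cases "x \<in> exvars (hc \<rho>) \<rho>")
      case True
      then show ?thesis by (auto simp: sk_subst_def B_def exvars_def)
    next
      case False
      then have "x \<in> set (frontier \<rho>)" using head_var_in_frontier[OF hc_rho x] by simp
      then show ?thesis using False assms(2) frontier_uvars by (auto simp: sk_subst_def \<sigma>_uc_def)
    qed
  qed
  also have "\<dots> = map_atom id (collapse B) ` out_hc hc (\<rho>, \<sigma>_uc)"
    unfolding out_hc_def out_def by (simp add: image_inst)
  also have "\<dots> \<subseteq> G" using assms(1) unfolding init_db_def init_def by auto
  finally show ?thesis
    unfolding obsolete_def using hc_rho by (intro bexI[of _ "hc \<rho>"] exI[of _ ?\<sigma>]) auto
qed

section \<open>Mapping the chase back into the overapproximation\<close>

context
  fixes \<phi> \<psi> \<tau>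
  assumes lift: "lifting \<phi>" and tr: "rpc_trigger \<psi> \<tau>" and nd: "\<not> datalog \<psi>"
begin

abbreviation "H \<equiv> retract \<phi> (\<psi>, \<tau>)"

abbreviation "Over \<equiv> overapprox R hc (\<psi>, \<tau>) (h_uc (\<psi>, \<tau>))"

abbreviation "K \<equiv> (skel (\<psi>, \<tau>) \<inter> range Const) \<union> {Const Star}"

lemma skel_T: "t \<in> skel (\<psi>, \<tau>) \<Longrightarrow> t \<in> T"
  using skel_subset_T[OF tr] by blast

lemma retract_lift: "t \<in> skel (\<psi>, \<tau>) \<Longrightarrow> H (\<phi> t) = t"
  using inj_on_subset[OF lifting_inj[OF lift] skel_subset_T[OF tr]]
  unfolding retract_def by simp

lemma retract_cases:
  obtains "H u \<in> skel (\<psi>, \<tau>)" "\<phi> (H u) = u" | "H u = Const Star" | f where "H u = Const (CFun f)"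
proof (cases "u \<in> \<phi> ` skel (\<psi>, \<tau>)")
  case True
  then show ?thesis using that(1) retract_lift by auto
next
  case False
  then have "H u = Const Star \<or> (\<exists>f. H u = Const (CFun f))"
    unfolding retract_def by (cases u) auto
  then show ?thesis using that(2,3) by blast
qed

text \<open>Outside the image of the skeleton, \<open>H\<close> takes only the values
  \<open>Star\<close> and \<open>CFun f\<close>, which do not occur in RPC.\<close>

lemma retract_in_T:
  assumes "H u \<in> T"
  shows "\<phi> (H u) = u"
  using assms by (cases rule: retract_cases[of u]) (auto dest: RPC_const)

lemma h_uc_retract: "h_uc (\<psi>, \<tau>) (H u) = H u"
  by (cases rule: retract_cases[of u]) (auto simp: h_uc_def)

lemma retract_terms_over: "H u \<in> terms_over R"
  by (cases rule: retract_cases[of u]) (auto intro: terms_over.intros T_terms_over skel_T)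

text \<open>A subterm of the image of $c_x$ is never the image of a functional term of RPC. So its
  preimage in the skeleton, if there is one, is a constant; without a preimage, it is a constant or
  belongs to \<open>old\<close>.\<close>

lemma retract_subterm:
  assumes x: "x \<in> uvars \<rho>" and u: "u \<in> subterms (\<phi> (\<sigma>_uc x))"
  shows "H u \<in> K"
proof (cases "u \<in> \<phi> ` skel (\<psi>, \<tau>)")
  case True
  then obtain t where t: "t \<in> skel (\<psi>, \<tau>)" "u = \<phi> t" by auto
  then have "t \<in> range Const" using lifting_not_subterm[OF lift _ x] u skel_T by (cases t) auto
  then show ?thesis using t retract_lift by auto
next
  case False
  have "u \<in> old \<phi>" if "u = Fn f ts" for f ts
    using that x u unfolding old_def by (cases f) auto
  then show ?thesis using False unfolding retract_def by (cases u) auto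
qed

lemma retract_old:
  assumes "u \<in> old \<phi>"
  shows "H u \<in> K"
proof (cases "u \<in> \<phi> ` skel (\<psi>, \<tau>)")
  case True
  then obtain t where t: "t \<in> skel (\<psi>, \<tau>)" "u = \<phi> t" by auto
  have "t \<noteq> Fn f ts" for f ts
    using lifting_sibling[OF lift, of f ts] assms skel_T[OF t(1)] t(2) unfolding old_def by auto
  then have "t \<in> range Const" by (cases t) auto
  then show ?thesis using t retract_lift by auto
next
  case False
  then show ?thesis using assms unfolding retract_def by auto
qed

lemma retract_constants_fact:
  assumes "(pname a, length (args a)) \<in> preds R" "\<And>t. t \<in> set (args a) \<Longrightarrow> H t \<in> K"
  shows "map_atom id H a \<in> Over"
proof (cases a)
  case (Atom p ts)
  have "Atom p (map H ts) \<in> Over"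
    using assms Atom by (intro overapprox.constants) auto
  then show ?thesis using Atom by simp
qed

text \<open>Under \<open>collapse B\<close>, the body facts are over the $c_x$, and the remaining
  facts are restored to the output of the initial trigger, which consists of birth facts. A
  substitution preserves functional terms, so there the constants of the database have only constant
  preimages.\<close>

lemma retract_init_db:
  assumes "a \<in> init_db"
  shows "map_atom id H a \<in> Over"
proof -
  obtain b where b: "b \<in> init" "a = map_atom id (collapse B) b"
    using assms unfolding init_db_def by auto
  have pr: "(pname a, length (args a)) \<in> preds R" using init_preds b by simp
  from lift show ?thesis
  proof (cases rule: lifting_cases)
    case 1
    from b(1) consider "b \<in> inst \<sigma>_uc (body \<rho>)" | "b \<in> out_hc hc (\<rho>, \<sigma>_uc)"
      unfolding init_def by auto
    then show ?thesis
    proof cases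
      assume "b \<in> inst \<sigma>_uc (body \<rho>)"
      then have "t \<in> \<sigma>_uc ` uvars \<rho>" if "t \<in> set (args b)" for t
        using inst_args[OF _ that] unfolding uvars_def by blast
      then have "t \<in> \<sigma>_uc ` uvars \<rho>" if "t \<in> set (args a)" for t
        using that b(2) 1 by fastforce
      then have "H t \<in> K" if "t \<in> set (args a)" for t
        using that retract_subterm 1(2) subterms_refl by (metis imageE)
      then show ?thesis by (rule retract_constants_fact[OF pr])
    next
      assume "b \<in> out_hc hc (\<rho>, \<sigma>_uc)"
      then have birth: "b \<in> birth (\<psi>, \<tau>)" using start_subset_birth[OF tr nd] by auto
      then have "t \<in> skel (\<psi>, \<tau>)" if "t \<in> set (args b)" for t
        using that unfolding skel_def terms_def by fastforce
      then have "map_atom id H a = b"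
        unfolding b(2) 1(1)[symmetric] using retract_lift
        by (cases b) (auto intro!: map_idI)
      then show ?thesis using birth by (auto intro: overapprox.birth)
    qed
  next
    case (2 \<theta>)
    have "H t \<in> K" if "t \<in> set (args a)" for t
    proof -
      have "t \<in> range Const" using that b init_args collapse_const by fastforce
      then show ?thesis
      proof (cases "t \<in> \<phi> ` skel (\<psi>, \<tau>)")
        case True
        then obtain s where s: "s \<in> skel (\<psi>, \<tau>)" "t = \<phi> s" by auto
        then have "s \<in> range Const" using \<open>t \<in> range Const\<close> 2(2) by (cases s) auto
        then show ?thesis using s retract_lift by auto
      next
        case False
        then show ?thesis using \<open>t \<in> range Const\<close> unfolding retract_def by auto
      qed
    qed
    then show ?thesis by (rule retract_constants_fact[OF pr])
  qed
qed

text \<open>\<phi> inverts \<open>H\<close> on the arguments, as they belong to \<open>T\<close>.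
  Commuting with the symbol could fail only for \<open>collapse B\<close> at a base term; but then
  the trigger would be \<rho> with frontier values \<open>cs\<close>, which is obsolete.\<close>

lemma retract_skolem_term:
  assumes T: "Fn (Sk \<psi>' i v) (map (H \<circ> \<tau>') (frontier \<psi>')) \<in> T"
    and G: "init_db \<subseteq> G" "\<not> obsolete (\<psi>', \<tau>') G"
  shows "\<phi> (Fn (Sk \<psi>' i v) (map (H \<circ> \<tau>') (frontier \<psi>'))) = Fn (Sk \<psi>' i v) (map \<tau>' (frontier \<psi>'))"
proof -
  have eq: "\<phi> (H (\<tau>' x)) = \<tau>' x" if "x \<in> set (frontier \<psi>')" for x
    using args_in_terms[OF T, of "H (\<tau>' x)"] that by (intro retract_in_T) auto
  from lift show ?thesis
  proof (cases rule: lifting_cases)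
    case 1
    have "Fn (Sk \<psi>' i v) (map (H \<circ> \<tau>') (frontier \<psi>')) \<notin> B"
    proof
      assume "Fn (Sk \<psi>' i v) (map (H \<circ> \<tau>') (frontier \<psi>')) \<in> B"
      then have *: "\<psi>' = \<rho>" "map (H \<circ> \<tau>') (frontier \<rho>) = cs" unfolding B_def by auto
      then have "\<tau>' x = \<sigma>_uc x" if "x \<in> set (frontier \<rho>)" for x
        using eq[of x] 1(2) that by simp
      then have "map \<tau>' (frontier \<rho>) = cs" by simp
      then show False using init_db_obsolete[OF G(1)] G(2) * by simp
    qed
    then show ?thesis using eq lifting_nonbase[OF lift] by simp
  next
    case (2 \<theta>)
    then show ?thesis using eq by simp
  qed
qed

text \<open>If the Skolem terms of the trigger are old, then its frontier values lie below the image
  of some $c_x$, and \<open>H\<close> turns the output into facts over constants. Otherwise the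
  overapproximation applies the same rule under \<open>H \<circ> \<tau>'\<close>, and
  \<open>h_uc\<close> of that output is \<open>H\<close> of the original one.\<close>

lemma retract_step:
  assumes t': "is_trigger R (\<psi>', \<tau>')" and ld: "loaded (\<psi>', \<tau>') G"
    and G: "init_db \<subseteq> G" "\<not> obsolete (\<psi>', \<tau>') G"
    and IH: "map_atom id H ` G \<subseteq> Over"
    and neq: "out_hc hc (\<psi>', \<tau>') \<noteq> out_hc hc (\<psi>, \<phi> \<circ> \<tau>)"
  shows "map_atom id H ` out_hc hc (\<psi>', \<tau>') \<subseteq> Over"
proof -
  have R: "\<psi>' \<in> R" using t' unfolding is_trigger_def by auto
  let ?i = "hc \<psi>'"
  note i = hc[OF R]
  let ?n = "\<lambda>v. Fn (Sk \<psi>' ?i v) (map \<tau>' (frontier \<psi>'))"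
  let ?t = "\<lambda>v. Fn (Sk \<psi>' ?i v) (map (H \<circ> \<tau>') (frontier \<psi>'))"
  show ?thesis
  proof (cases "\<exists>v. ?n v \<in> old \<phi>")
    case True
    then obtain w' x\<^sub>0 where w': "x\<^sub>0 \<in> uvars \<rho>" "?n w' \<in> subterms (\<phi> (\<sigma>_uc x\<^sub>0))"
      unfolding old_def by auto
    then have old: "?n v \<in> old \<phi>" for v unfolding old_def by auto
    show ?thesis
    proof (rule image_subsetI)
      fix a assume a: "a \<in> out_hc hc (\<psi>', \<tau>')"
      have "H t \<in> K" if "t \<in> set (args a)" for t
      proof -
        obtain x where x: "x \<in> vars (head ?i \<psi>')" "t = sk_subst ?i \<psi>' \<tau>' x"
          using inst_args[of a, OF _ \<open>t \<in> set (args a)\<close>] a unfolding out_hc_def out_def fst_conv snd_conv by blast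
        show ?thesis
        proof (cases "x \<in> exvars ?i \<psi>'")
          case True
          then show ?thesis using x retract_old[OF old] by (simp add: sk_subst_def)
        next
          case False
          then have "t \<in> subterms (?n w')"
            using x head_var_in_frontier[OF i x(1)] by (auto simp: sk_subst_def intro!: bexI)
          then show ?thesis using retract_subterm[OF w'(1)] w'(2) subterms_trans by blast
        qed
      qed
      then show "map_atom id H a \<in> Over"
        using a head_preds[OF R i] unfolding out_hc_def out_def
        by (intro retract_constants_fact) auto
    qed
  next
    case False
    \<comment> \<open>If \<open>?t v\<close> is in the skeleton, \<phi> sends it to
      \<open>?n v\<close>. If not, \<open>?n v\<close> has no preimage in the skeleton: a functional
      preimage would be \<open>?t v\<close> itself, and a constant one would make
      \<open>?n v\<close> old. Then both sides are the constant of the same Skolem symbol.\<close>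
    have skolem: "h_uc (\<psi>, \<tau>) (?t v) = H (?n v)" for v
    proof (cases "?t v \<in> skel (\<psi>, \<tau>)")
      case True
      then have "H (?n v) = ?t v"
        using retract_lift[OF True] retract_skolem_term[OF skel_T[OF True] G] by simp
      then show ?thesis using True by (simp add: h_uc_def)
    next
      case nskel: False
      have "?n v \<notin> \<phi> ` skel (\<psi>, \<tau>)"
      proof
        assume "?n v \<in> \<phi> ` skel (\<psi>, \<tau>)"
        then obtain t where t: "t \<in> skel (\<psi>, \<tau>)" "?n v = \<phi> t" by auto
        from skel_T[OF t(1)] show False
        proof (cases rule: T_cases)
          case (1 x)
          then have "?n v \<in> subterms (\<phi> (\<sigma>_uc x))" using t by simp
          then show False using False 1(1) unfolding old_def by blast
        next
          case (2 f ts)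
          then have f: "f = Sk \<psi>' ?i v" "map \<tau>' (frontier \<psi>') = map \<phi> ts"
            using lifting_Fn[OF lift] t(2) by metis+
          have "map H (map \<phi> ts) = ts"
            using retract_lift skel_args[of f ts "(\<psi>, \<tau>)"] t(1) 2 by (auto intro!: map_idI)
          then have "?t v = t" using f 2 by (metis map_map)
          then show False using nskel t by simp
        qed
      qed
      then show ?thesis using nskel False by (simp add: h_uc_def retract_def)
    qed
    have image: "map_atom id (h_uc (\<psi>, \<tau>)) ` out ?i (\<psi>', H \<circ> \<tau>') = map_atom id H ` out ?i (\<psi>', \<tau>')"
      by (rule out_image_eq[OF i]) (use skolem in \<open>auto simp: h_uc_retract\<close>)
    \<comment> \<open>If the pulled-back output were that of the trigger under test, it would lie in
      RPC, where \<phi> undoes \<open>H\<close>. Applying \<phi> to both outputs would then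
      contradict \<open>neq\<close>.\<close>
    have neq': "out_hc hc (\<psi>', H \<circ> \<tau>') \<noteq> out_hc hc (\<psi>, \<tau>)"
    proof
      assume eq: "out_hc hc (\<psi>', H \<circ> \<tau>') = out_hc hc (\<psi>, \<tau>)"
      then have sub: "terms (out ?i (\<psi>', H \<circ> \<tau>')) \<subseteq> T"
        using tr terms_mono unfolding rpc_trigger_def out_hc_def by auto
      have "map_atom id \<phi> ` out ?i (\<psi>', H \<circ> \<tau>') = map_atom id (\<lambda>t. t) ` out ?i (\<psi>', \<tau>')"
      proof (rule out_image_eq[OF i])
        fix x assume x: "x \<in> set (frontier \<psi>')" "x \<in> vars (head ?i \<psi>')"
        then have "(H \<circ> \<tau>') x = sk_subst ?i \<psi>' (H \<circ> \<tau>') x"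
          using frontier_uvars[OF x(1)] by (simp add: sk_subst_def exvars_def)
        then have "(H \<circ> \<tau>') x \<in> terms (out ?i (\<psi>', H \<circ> \<tau>'))"
          unfolding out_def terms_inst using x(2) by (auto intro!: bexI)
        then show "\<phi> ((H \<circ> \<tau>') x) = \<tau>' x" using sub retract_in_T by auto
      next
        fix v assume "v \<in> exvars ?i \<psi>'"
        then have "?t v \<in> T" by (rule subsetD[OF sub skolem_in_out])
        then show "\<phi> (?t v) = ?n v" using retract_skolem_term G by blast
      qed
      then have "out_hc hc (\<psi>', \<tau>') = map_atom id \<phi> ` out_hc hc (\<psi>', H \<circ> \<tau>')"
        by (simp add: map_atom_ident out_hc_def)
      then show False using neq eq lifting_out[OF lift tr] by simp
    qed
    have "map_atom id (h_uc (\<psi>, \<tau>)) a \<in> Over" if "a \<in> out_hc hc (\<psi>', H \<circ> \<tau>')" for a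
    proof (rule overapprox.trigger[OF _ _ neq' that])
      show "is_trigger R (\<psi>', H \<circ> \<tau>')"
        using R retract_terms_over unfolding is_trigger_def by auto
      show "\<forall>b\<in>inst (snd (\<psi>', H \<circ> \<tau>')) (body (fst (\<psi>', H \<circ> \<tau>'))). b \<in> Over"
        using ld IH unfolding loaded_def by (auto simp flip: image_inst)
    qed
    then have "map_atom id (h_uc (\<psi>, \<tau>)) ` out ?i (\<psi>', H \<circ> \<tau>') \<subseteq> Over"
      unfolding out_hc_def fst_conv by (rule image_subsetI)
    then show ?thesis unfolding image out_hc_def fst_conv .
  qed
qed

lemma retract_hc_chase:
  assumes "hc_chase R hc init_db G" "\<not> out_hc hc (\<psi>, \<phi> \<circ> \<tau>) \<subseteq> G"
  shows "map_atom id H ` G \<subseteq> Over"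
  using assms
proof (induction rule: hc_chase.induct)
  case root
  show ?case by (rule image_subsetI) (rule retract_init_db)
next
  case (step G l)
  obtain \<psi>' \<tau>' where l: "l = (\<psi>', \<tau>')" by (cases l)
  have "\<not> out_hc hc (\<psi>, \<phi> \<circ> \<tau>) \<subseteq> G" using step.prems by blast
  then have IH: "map_atom id H ` G \<subseteq> Over" by (rule step.IH)
  have "map_atom id H ` out_hc hc l \<subseteq> Over"
    unfolding l
  proof (rule retract_step[of _ _ G])
    \<comment> \<open>Equal outputs would put the lifted output into the extended fact set, against
      the assumption on it.\<close>
    show "out_hc hc (\<psi>', \<tau>') \<noteq> out_hc hc (\<psi>, \<phi> \<circ> \<tau>)"
      using step.prems unfolding l by blast
  qed (use step.hyps IH hc_chase_mono[OF step.hyps(1)] in \<open>simp_all add: l\<close>)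
  then show ?case using IH unfolding image_Un by blast
qed

end

section \<open>Lifting RPC into the leaf\<close>

lemma lifted_trigger_fires:
  assumes F: "hc_chase R hc init_db F" "\<forall>\<psi>\<in>R. satisfies F \<psi>"
    and lift: "lifting \<phi>" and tr: "rpc_trigger \<psi> \<tau>"
    and ld: "inst (\<phi> \<circ> \<tau>) (body \<psi>) \<subseteq> F"
  shows "out_hc hc (\<psi>, \<phi> \<circ> \<tau>) \<subseteq> F"
proof (rule ccontr)
  assume not: "\<not> out_hc hc (\<psi>, \<phi> \<circ> \<tau>) \<subseteq> F"
  have R: "\<psi> \<in> R" using tr unfolding rpc_trigger_def is_trigger_def by auto
  then have "obsolete (\<psi>, \<phi> \<circ> \<tau>) F" using F(2) ld unfolding satisfies_def loaded_def by auto
  then obtain i \<sigma> where i: "i \<in> {1..branching \<psi>}" and \<sigma>: "\<And>x. x \<in> uvars \<psi> \<Longrightarrow> \<sigma> x = \<phi> (\<tau> x)"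
    and sub: "inst \<sigma> (head i \<psi>) \<subseteq> F" unfolding obsolete_def by fastforce
  show False
  proof (cases "datalog \<psi>")
    case True
    then have "i = hc \<psi>" "exvars i \<psi> = {}"
      using i hc[OF R] unfolding datalog_def generating_def by auto
    then have "out_hc hc (\<psi>, \<phi> \<circ> \<tau>) = inst \<sigma> (head i \<psi>)"
      unfolding out_hc_def out_def fst_conv snd_conv using \<sigma>
      by (auto intro!: inst_cong arg_cong2[where f = inst] simp: sk_subst_def exvars_def)
    then show False using sub not by simp
  next
    case False
    let ?H = "retract \<phi> (\<psi>, \<tau>)" and ?O = "overapprox R hc (\<psi>, \<tau>) (h_uc (\<psi>, \<tau>))"
    \<comment> \<open>The head contains only those universal variables that belong to the frontier,
      and there \<open>H\<close> after \<sigma> returns \<tau>. On the other body variables \<tau>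
      is prescribed, so that the substitution extends \<tau>.\<close>
    let ?\<sigma> = "\<lambda>x. if x \<in> uvars \<psi> then \<tau> x else ?H (\<sigma> x)"
    have "inst ?\<sigma> (head i \<psi>) = inst (?H \<circ> \<sigma>) (head i \<psi>)"
    proof (rule inst_cong)
      fix x assume x: "x \<in> vars (head i \<psi>)"
      show "?\<sigma> x = (?H \<circ> \<sigma>) x"
      proof (cases "x \<in> uvars \<psi>")
        case True
        then have "x \<in> set (frontier \<psi>)"
          using head_var_in_frontier[OF i x] by (auto simp: exvars_def)
        then show ?thesis
          using True \<sigma> retract_lift[OF lift tr False frontier_in_skel[OF tr]] by simp
      qed simp
    qed
    also have "\<dots> = map_atom id ?H ` inst \<sigma> (head i \<psi>)" by (simp add: image_inst)
    also have "\<dots> \<subseteq> ?O" using retract_hc_chase[OF lift tr False F(1) not] sub by blast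
    finally have "obsolete (\<psi>, \<tau>) ?O"
      unfolding obsolete_def using i by (intro bexI[of _ i] exI[of _ ?\<sigma>]) auto
    then show False using tr False unfolding rpc_trigger_def uc_unblockable_def by auto
  qed
qed

lemma lifted_RPC:
  assumes F: "hc_chase R hc init_db F" "\<forall>\<psi>\<in>R. satisfies F \<psi>"
    and lift: "lifting \<phi>" and init: "map_atom id \<phi> ` init \<subseteq> F"
  shows "map_atom id \<phi> ` RPC R hc \<rho> \<subseteq> F"
proof (rule image_subsetI)
  fix a assume "a \<in> RPC R hc \<rho>"
  then show "map_atom id \<phi> a \<in> F"
  proof (induction rule: RPC.induct)
    case (trigger \<psi> \<tau> a)
    have tr: "rpc_trigger \<psi> \<tau>"
      unfolding rpc_trigger_def loaded_def using trigger by (auto intro: RPC.trigger)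
    have "inst (\<phi> \<circ> \<tau>) (body \<psi>) \<subseteq> F"
      unfolding image_inst[symmetric] using trigger.IH by blast
    then have "out_hc hc (\<psi>, \<phi> \<circ> \<tau>) \<subseteq> F" by (rule lifted_trigger_fires[OF F lift tr])
    then show ?case using trigger.hyps lifting_out[OF lift tr] by blast
  qed (use init in \<open>unfold init_def, blast\<close>)+
qed

section \<open>Iterating the lifting\<close>

text \<open>The new map composes \<phi> with \<tau> on the $c_x$. It is injective there since \<tau>
  is injective on the body of \<rho> and \<phi> on \<open>T\<close>; the assumption
  \<open>first\<close> yields the last condition of \<open>lifting\<close>. The image of a base term
  grows because some argument of the corresponding Skolem term over \<tau> contains a base
  term.\<close>

lemma lifting_next:
  assumes F: "hc_chase R hc init_db F" "\<forall>\<psi>\<in>R. satisfies F \<psi>"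
    and tr: "rpc_trigger \<rho> \<tau>"
    and first: "\<forall>x\<in>uvars \<rho>. \<forall>y. Fn (fsym y) (map \<tau> (frontier \<rho>)) \<notin> subterms (\<tau> x)"
    and ex: "v \<in> exvars (hc \<rho>) \<rho>"
    and lift: "lifting \<phi>" and init: "map_atom id \<phi> ` init \<subseteq> F"
  obtains \<phi>' where "lifting \<phi>'" "map_atom id \<phi>' ` init \<subseteq> F"
    "\<And>b. b \<in> B \<Longrightarrow> \<exists>b'\<in>B. fn_count (\<phi> b') < fn_count (\<phi>' b)"
proof
  let ?S = "map \<tau> (frontier \<rho>)"
  define \<phi>' where "\<phi>' = csubst (\<lambda>c. case c of CVar x \<Rightarrow> \<phi> (\<tau> x) | _ \<Rightarrow> Const c)"
  have var: "\<phi>' (\<sigma>_uc x) = \<phi> (\<tau> x)" for x unfolding \<phi>'_def by (simp add: \<sigma>_uc_def)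
  have fn: "\<phi>' (Fn f ts) = Fn f (map \<phi>' ts)" for f ts unfolding \<phi>'_def by simp
  have cs: "map \<phi>' cs = map \<phi> ?S" using var by simp
  have base: "\<phi>' (Fn (fsym y) cs) = \<phi> (Fn (fsym y) ?S)" for y
    using lifting_nonbase[OF lift trigger_term_not_base[OF tr ex]] by (simp add: fn var)
  have skolem: "Fn (fsym y) ?S \<in> T" if "y \<in> exvars (hc \<rho>) \<rho>" for y
    using skolem_in_out[OF that] tr terms_mono unfolding rpc_trigger_def out_hc_def fst_conv by blast
  have uv: "\<tau> x \<in> T" if "x \<in> uvars \<rho>" for x using rpc_trigger_uvar[OF tr that] .
  have v: "\<phi> (Fn (fsym y) ?S) = Fn (fsym y) (map \<phi> ?S)" for y
    by (rule lifting_nonbase[OF lift trigger_term_not_base[OF tr ex]])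
  show "lifting \<phi>'"
    unfolding lifting_def
  proof (intro conjI ballI allI)
    show "\<phi>' = collapse B \<or> (\<exists>\<theta>. \<phi>' = csubst \<theta>)" unfolding \<phi>'_def by blast
    show "inj_on \<phi>' (\<sigma>_uc ` uvars \<rho>)"
    proof (rule inj_onI, clarify)
      fix x y assume xy: "x \<in> uvars \<rho>" "y \<in> uvars \<rho>" "\<phi>' (\<sigma>_uc x) = \<phi>' (\<sigma>_uc y)"
      then have "\<tau> x = \<tau> y" using inj_onD[OF lifting_inj[OF lift]] uv by (simp add: var)
      then have "x = y" using tr xy unfolding rpc_trigger_def by (auto dest: inj_onD)
      then show "\<sigma>_uc x = \<sigma>_uc y" by simp
    qed
    fix x y assume x: "x \<in> uvars \<rho>"
    show "Fn (fsym y) (map \<phi>' cs) \<notin> subterms (\<phi>' (\<sigma>_uc x))"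
    proof
      assume "Fn (fsym y) (map \<phi>' cs) \<in> subterms (\<phi>' (\<sigma>_uc x))"
      then have sub: "Fn (fsym y) (map \<phi> ?S) \<in> subterms (\<phi> (\<tau> x))"
        unfolding cs var .
      \<comment> \<open>An occurrence in the image of \<tau> \<open>x\<close> is either inside the
        image of some $c_x$, which \<open>lifting_sibling\<close> excludes, or the image of a
        subterm of \<tau> \<open>x\<close>. By injectivity of \<phi> that subterm is a Skolem term
        over \<open>?S\<close>, which \<open>first\<close> excludes.\<close>
      have nvar: "Fn (fsym y) (map \<phi> ?S) \<notin> subterms (\<phi> (\<sigma>_uc x'))" if "x' \<in> uvars \<rho>" for x'
        using lifting_sibling[OF lift skolem[OF ex] _ that] v by blast
      then obtain t where t: "t \<in> subterms (\<tau> x)" "Fn (fsym y) (map \<phi> ?S) = \<phi> t"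
        using lifting_subterms[OF lift uv[OF x] sub] by auto
      then have tT: "t \<in> T" using terms_subterms uv[OF x] by blast
      then show False
      proof (cases rule: T_cases)
        case (1 x')
        then show False using nvar t(2) subterms_refl by metis
      next
        case (2 f ts)
        then have f: "f = fsym y" "map \<phi> ts = map \<phi> ?S"
          using lifting_Fn[OF lift] t(2) by metis+
        have "ts = ?S"
        proof (rule map_inj_on[OF f(2)])
          have "set ts \<subseteq> T" using args_in_terms tT 2 by blast
          moreover have "set ?S \<subseteq> T" using uv[OF frontier_uvars] by auto
          ultimately show "inj_on \<phi> (set ts \<union> set ?S)"
            using inj_on_subset[OF lifting_inj[OF lift]] by simp
        qed
        then show False using first x t(1) f 2 by auto
      qed
    qed
  qed
  have image: "map_atom id \<phi> ` G \<subseteq> F" if "G \<subseteq> RPC R hc \<rho>" for G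
    using image_mono[OF that] lifted_RPC[OF F lift init] by (rule subset_trans)
  \<comment> \<open>The new map treats the initial trigger as \<phi> treats the trigger of \<rho>
    with \<tau>, whose body and output are in RPC and thus are sent into \<open>F\<close>.\<close>
  have "map_atom id \<phi>' ` inst \<sigma>_uc (body \<rho>) = map_atom id \<phi> ` inst \<tau> (body \<rho>)"
    by (auto simp: image_inst var intro!: inst_cong)
  also have "\<dots> \<subseteq> F"
    using tr by (intro image) (simp add: rpc_trigger_def loaded_def)
  finally have "map_atom id \<phi>' ` inst \<sigma>_uc (body \<rho>) \<subseteq> F" .
  moreover have "map_atom id \<phi>' ` out_hc hc (\<rho>, \<sigma>_uc) = map_atom id \<phi> ` out_hc hc (\<rho>, \<tau>)"
    unfolding out_hc_def fst_conv by (rule out_image_eq[OF hc_rho]) (use var base in auto)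
  moreover have "map_atom id \<phi> ` out_hc hc (\<rho>, \<tau>) \<subseteq> F"
    using tr by (intro image) (simp add: rpc_trigger_def)
  ultimately show "map_atom id \<phi>' ` init \<subseteq> F"
    unfolding init_def image_Un by simp
  fix b assume "b \<in> B"
  then obtain y where y: "y \<in> exvars (hc \<rho>) \<rho>" "b = Fn (fsym y) cs" unfolding B_def by auto
  have "Fn (fsym y) ?S \<notin> B" by (rule trigger_term_not_base[OF tr ex])
  then obtain t b' where b': "t \<in> set ?S" "b' \<in> B" "b' \<in> subterms t"
    using base_subterm[OF skolem[OF y(1)]] by auto
  have "fn_count (\<phi> b') \<le> fn_count (\<phi> t)"
    using lift
  proof (cases rule: lifting_cases)
    case 1
    then have "\<phi> b' \<in> range Const" using b'(2) collapse_const by blast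
    then show ?thesis by auto
  next
    case (2 \<theta>)
    then show ?thesis using fn_count_subterms csubst_subterms b'(3) by blast
  qed
  also have "\<dots> < fn_count (\<phi>' b)"
  proof -
    have "\<phi> t \<in> set (map \<phi> ?S)" using b'(1) by auto
    from fn_count_arg[OF this] show ?thesis unfolding y(2) base v .
  qed
  finally have "fn_count (\<phi> b') < fn_count (\<phi>' b)" .
  then show "\<exists>b'\<in>B. fn_count (\<phi> b') < fn_count (\<phi>' b)" using b' by auto
qed

lemma base_arg:
  assumes "b \<in> B"
  shows "\<exists>a\<in>init. b \<in> set (args a)"
proof -
  obtain y where y: "y \<in> exvars (hc \<rho>) \<rho>" "b = Fn (fsym y) cs" using assms unfolding B_def by auto
  then obtain a where a: "a \<in> set (head (hc \<rho>) \<rho>)" "y \<in> set (args a)"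
    unfolding exvars_def vars_def by auto
  have "b = sk_subst (hc \<rho>) \<rho> \<sigma>_uc y" using y by (simp add: sk_subst_def)
  then have "b \<in> set (args (map_atom id (sk_subst (hc \<rho>) \<rho> \<sigma>_uc) a))" using a(2) by simp
  then show ?thesis using a(1) unfolding init_def out_hc_def out_def inst_def fst_conv snd_conv by blast
qed

lemma no_finite_leaf:
  assumes t: "t \<in> T" "rule_cyclic \<rho> t"
    and F: "hc_chase R hc init_db F" "\<forall>\<psi>\<in>R. satisfies F \<psi>"
  shows False
proof -
  obtain f ts s where f: "t = Fn f ts" "f \<in> sk_fsyms \<rho>" "s \<in> set ts" "f \<in> fsyms s"
    using t(2) unfolding rule_cyclic_def by auto
  obtain \<psi> \<tau> v where *: "f = Sk \<psi> (hc \<psi>) v" "v \<in> exvars (hc \<psi>) \<psi>" "ts = map \<tau> (frontier \<psi>)"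
    "(\<psi> = \<rho> \<and> \<tau> = \<sigma>_uc) \<or>
     (rpc_trigger \<psi> \<tau> \<and> (\<forall>x\<in>uvars \<psi>. \<forall>w. Fn (Sk \<psi> (hc \<psi>) w) ts \<notin> subterms (\<tau> x)))"
    using t(1) unfolding f(1) by (rule RPC_skolem_term)
  have \<psi>: "\<psi> = \<rho>" using *(1) f(2) unfolding sk_fsyms_def by auto
  \<comment> \<open>The arguments of a base term contain no function symbols, so the cyclic term was
    created by a later trigger of \<rho>.\<close>
  have "\<tau> \<noteq> \<sigma>_uc" using *(3) f(3,4) by (auto simp: \<sigma>_uc_def)
  then have tr: "rpc_trigger \<rho> \<tau>"
    and first: "\<forall>x\<in>uvars \<rho>. \<forall>y. Fn (fsym y) (map \<tau> (frontier \<rho>)) \<notin> subterms (\<tau> x)"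
    and ex: "v \<in> exvars (hc \<rho>) \<rho>"
    using * \<psi> by auto
  \<comment> \<open>The bound concerns all of \<open>B\<close> at once, since the base term
    \<open>b'\<close> below which the growth is measured may differ from \<open>b\<close>.\<close>
  have iter: "\<exists>\<phi>. lifting \<phi> \<and> map_atom id \<phi> ` init \<subseteq> F \<and> (\<forall>b\<in>B. n \<le> fn_count (\<phi> b))" for n
  proof (induction n)
    case 0
    have "map_atom id (collapse B) ` init \<subseteq> F"
      using hc_chase_mono[OF F(1)] unfolding init_db_def .
    then show ?case using lifting_collapse by blast
  next
    case (Suc n)
    then obtain \<phi> where \<phi>: "lifting \<phi>" "map_atom id \<phi> ` init \<subseteq> F" "\<forall>b\<in>B. n \<le> fn_count (\<phi> b)"
      by blast
    obtain \<phi>' where "lifting \<phi>'" "map_atom id \<phi>' ` init \<subseteq> F"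
      "\<And>b. b \<in> B \<Longrightarrow> \<exists>b'\<in>B. fn_count (\<phi> b') < fn_count (\<phi>' b)"
      using lifting_next[OF F tr first ex \<phi>(1,2)] by metis
    then show ?case using \<phi>(3) by (metis Suc_leI le_less_trans)
  qed
  have fin: "finite (terms F)"
    using finite_terms hc_chase_finite[OF F(1)] database_init_db unfolding database_def by auto
  obtain \<phi> where \<phi>: "map_atom id \<phi> ` init \<subseteq> F" "\<forall>b\<in>B. Suc (Max (fn_count ` terms F)) \<le> fn_count (\<phi> b)"
    using iter by blast
  have B: "Fn (fsym v) cs \<in> B" using ex unfolding B_def by auto
  then obtain a where a: "a \<in> init" "Fn (fsym v) cs \<in> set (args a)" using base_arg by blast
  then have "\<phi> (Fn (fsym v) cs) \<in> set (args (map_atom id \<phi> a))" unfolding args_map_atom set_map by blast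
  moreover have "map_atom id \<phi> a \<in> F" using \<phi>(1) a(1) by blast
  ultimately have "\<phi> (Fn (fsym v) cs) \<in> terms F" unfolding terms_def using subterms_refl by blast
  then have "fn_count (\<phi> (Fn (fsym v) cs)) \<le> Max (fn_count ` terms F)" using fin by simp
  then show False using \<phi>(2) B by fastforce
qed

end

theorem theorem5:
  fixes R :: "('p, 'v) rule set"
  assumes "rule_set R" and "is_RPC_s R"
  shows "never_terminates R"
proof -
  from assms(2) obtain i \<rho> t where i: "1 \<le> i" and rho: "\<rho> \<in> R"
    and t: "t \<in> terms (RPC R (hc_const i) \<rho>)" "rule_cyclic \<rho> t"
    unfolding is_RPC_s_def by auto
  have hc: "hc_const i \<psi> \<in> {1..branching \<psi>}" if "\<psi> \<in> R" for \<psi>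
    using assms(1) that i unfolding rule_set_def hc_const_def branching_def
    by (cases "heads \<psi>") auto
  interpret rpc R "hc_const i" \<rho>
    using rho hc by unfold_locales
  have "\<not> (chase_tree R init_db V fct trg \<and> finite V)" for V fct trg
  proof
    assume "chase_tree R init_db V fct trg \<and> finite V"
    then obtain F where "hc_chase R (hc_const i) init_db F" "\<forall>\<psi>\<in>R. satisfies F \<psi>"
      using finite_chase_tree_hc_leaf[of R "hc_const i"] hc by metis
    then show False using no_finite_leaf t by blast
  qed
  then show ?thesis unfolding never_terminates_def using database_init_db by blast
qed

end
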